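(* Let $m\ge 1$, let $\Omega\subset\mathbb{R}^{m+1}$ be a domain, let $e_1,\dots,e_{m+1}$ be (pointwise linearly) independent $C^\infty$ vector fields on $\Omega$, and let $Q'$ be the operator $$Q'\phi=a^{ij}(x,e_1\phi,\dots,e_{m+1}\phi)\,e_ie_j\phi+b(x,\phi,e_1\phi,\dots,e_{m+1}\phi)$$ (summation over repeated indices), where $a^{ij}=a^{ij}(x,p)$ is $C^\infty$ on $\Omega\times\mathbb{R}^{m+1}$ and $b=b(x,z,p)$ is $C^\infty$ on $\Omega\times\mathbb{R}\times\mathbb{R}^{m+1}$. Let $\phi,\psi\in C^\infty(\Omega)$ satisfy $Q'\phi\ge Q'\psi$ in $\Omega$. Assume: (1) the matrix $(a^{ij})$ is nonnegative and $a^{ij}=a^{ji}$; (2) $\frac{\partial b}{\partial z}\le 0$; (3) there exist $C^\infty$ vector fields $X_1,\dots,X_r$ and $Y$ on $\Omega$ (depending on $e_1\phi(x),\dots,e_{m+1}\phi(x)$) such that, as differential operators, $$a^{ij}(x,e_1\phi(x),\dots,e_{m+1}\phi(x))\,e_ie_j=\sum_{k=1}^r X_k^2+Y.$$ Let $\Gamma$ be an integral curve of a vector field $Z\in\mathcal{L}(X_1,\dots,X_r)$. Suppose $\phi-\psi$ achieves a nonnegative maximum in $\Omega$ at a point of $\Gamma$. Then the maximum is attained at all points of $\Gamma$.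
   Context: For $C^\infty$ vector fields $X_1,\dots,X_r$ on $\Omega$, $\mathcal{L}(X_1,\dots,X_r)$ denotes the smallest $C^\infty(\Omega)$-module of vector fields which contains $X_1,\dots,X_r$ and is closed under the Lie bracket; its elements are finite sums of terms $\lambda[X_{i_1},[X_{i_2},\dots,[X_{i_{l-1}},X_{i_l}]]]$ with $\lambda\in C^\infty(\Omega)$ and $i_k\in\{1,\dots,r\}$ (including $l=1$, i.e. $\lambda X_{i_1}$). *)

theory Defs
  imports "HOL-Analysis.Analysis"
begin

(* Intended for open S, where the two-sided derivative at each point of S depends only on
   the values of f in S. *)
primrec times_differentiable_on ::
    "nat \<Rightarrow> 'a::euclidean_space set \<Rightarrow> ('a \<Rightarrow> 'b::real_normed_vector) \<Rightarrow> bool" where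
  "times_differentiable_on 0 S f \<longleftrightarrow> continuous_on S f"
| "times_differentiable_on (Suc k) S f \<longleftrightarrow>
     (\<forall>x\<in>S. f differentiable (at x)) \<and>
     (\<forall>v. times_differentiable_on k S (\<lambda>x. frechet_derivative f (at x) v))"

definition smooth_on :: "'a::euclidean_space set \<Rightarrow> ('a \<Rightarrow> 'b::real_normed_vector) \<Rightarrow> bool" where
  "smooth_on S f \<longleftrightarrow> (\<forall>k. times_differentiable_on k S f)"

(* A vector field on an open set S is a total function 'a => 'a of which only the values on S
   matter; it acts on functions by differentiation. *)
definition vf_apply :: "('a \<Rightarrow> 'a) \<Rightarrow> ('a::euclidean_space \<Rightarrow> real) \<Rightarrow> 'a \<Rightarrow> real" where
  "vf_apply X u x = frechet_derivative u (at x) (X x)"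

(* Sign convention: [X,Y] u = X (Y u) - Y (X u). *)
definition lie_bracket :: "('a \<Rightarrow> 'a) \<Rightarrow> ('a \<Rightarrow> 'a) \<Rightarrow> 'a::euclidean_space \<Rightarrow> 'a" where
  "lie_bracket X Y x =
     frechet_derivative Y (at x) (X x) - frechet_derivative X (at x) (Y x)"

(* Rule cong identifies fields that agree on S: a total function belongs to the module
   iff its restriction to S does. *)
inductive_set lie_module :: "'a::euclidean_space set \<Rightarrow> ('a \<Rightarrow> 'a) set \<Rightarrow> ('a \<Rightarrow> 'a) set"
  for S :: "'a set" and G :: "('a \<Rightarrow> 'a) set" where
  gen: "X \<in> G \<Longrightarrow> X \<in> lie_module S G"
| zero: "(\<lambda>x. 0) \<in> lie_module S G"
| add: "X \<in> lie_module S G \<Longrightarrow> Y \<in> lie_module S G \<Longrightarrow> (\<lambda>x. X x + Y x) \<in> lie_module S G"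
| scale: "smooth_on S f \<Longrightarrow> X \<in> lie_module S G \<Longrightarrow> (\<lambda>x. f x *\<^sub>R X x) \<in> lie_module S G"
| bracket: "X \<in> lie_module S G \<Longrightarrow> Y \<in> lie_module S G \<Longrightarrow> lie_bracket X Y \<in> lie_module S G"
| cong: "X \<in> lie_module S G \<Longrightarrow> (\<And>x. x \<in> S \<Longrightarrow> X' x = X x) \<Longrightarrow> X' \<in> lie_module S G"

(* The parameter interval I may be open, closed, half-open or unbounded; derivatives at
   endpoints belonging to I are one-sided. *)
definition integral_curve ::
    "'a::euclidean_space set \<Rightarrow> ('a \<Rightarrow> 'a) \<Rightarrow> real set \<Rightarrow> (real \<Rightarrow> 'a) \<Rightarrow> bool" where
  "integral_curve S Z I \<gamma> \<longleftrightarrow>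
     is_interval I \<and> \<gamma> ` I \<subseteq> S \<and>
     (\<forall>t\<in>I. (\<gamma> has_vector_derivative Z (\<gamma> t)) (at t within I))"

definition frame_gradient ::
    "('n \<Rightarrow> real^'n \<Rightarrow> real^'n) \<Rightarrow> (real^'n \<Rightarrow> real) \<Rightarrow> real^'n::finite \<Rightarrow> real^'n" where
  "frame_gradient e u x = (\<chi> i. vf_apply (e i) u x)"

definition quasilinear_op ::
    "('n \<Rightarrow> real^'n \<Rightarrow> real^'n) \<Rightarrow> ('n \<Rightarrow> 'n \<Rightarrow> real^'n \<Rightarrow> real^'n \<Rightarrow> real) \<Rightarrow>
     (real^'n \<Rightarrow> real \<Rightarrow> real^'n \<Rightarrow> real) \<Rightarrow> (real^'n \<Rightarrow> real) \<Rightarrow> real^'n::finite \<Rightarrow> real" where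
  "quasilinear_op e a b u x =
     (\<Sum>i\<in>UNIV. \<Sum>j\<in>UNIV.
        a i j x (frame_gradient e u x) * vf_apply (e i) (vf_apply (e j) u) x)
     + b x (u x) (frame_gradient e u x)"

end

theory Submission
  imports Defs
begin

text \<open>Put \<open>u = \<phi> - \<psi>\<close> and let \<open>F\<close> be the set where \<open>u\<close> attains its maximum \<open>M \<ge> 0\<close>. Linearising
  \<open>Q'\<close> gives, on compact sets, \<open>\<Sum> X\<^sub>k\<^sup>2 u \<ge> - C (\<bar>\<nabla>u\<bar> + u\<^sup>-)\<close>. Following Bony, a Hopf barrier then shows
  that every \<open>X\<^sub>k\<close> is orthogonal to the normals of exterior balls touching \<open>F\<close>. The fields with this property
  form a module, which is closed under brackets because approximate flow commutators starting
  in \<open>F\<close> stay within \<open>o(t\<^sup>2)\<close> of \<open>F\<close>. So \<open>Z\<close> has the property, and a Gronwall estimate for the squared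
  distance to \<open>F\<close> shows that its integral curves cannot leave \<open>F\<close>.\<close>

section \<open>Calculus of smooth maps\<close>

text \<open>\<open>F\<close> is merely relatively closed: it has no tangent space and its distance
  function need not be differentiable. A bracket therefore cannot be reached by differentiating a
  defining function of \<open>F\<close>; the second-order information has to come from points that
  lie in \<open>F\<close>. Exact flows are avoided. Quadratic polynomials in time that solve the
  equation of the field up to \<open>o(t)\<close> replace them, and their endpoints are moved to
  nearest points of \<open>F\<close>. One estimate, that an approximate integral curve starting in
  \<open>F\<close> is at a distance from \<open>F\<close> of at most a constant times error times
  time, then serves both for brackets and for the final curve, where the error is 0. In the
  linearisation the second-order part keeps the coefficients taken at \<open>\<phi>\<close>, so that
  the sum-of-squares hypothesis applies to it; the coefficient difference multiplies second
  derivatives of \<open>\<psi>\<close>, bounded on compact sets, and like \<open>Y\<close> costs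
  only a gradient term. The sign of \<open>M\<close> enters through \<open>u\<^sup>-\<close>: at the
  maximum of the perturbed function, \<open>u\<close> is at least minus a term of the size of the
  barrier itself.\<close>

lemma frechet_derivative_cong_open:
  assumes "open S" "x \<in> S" "f differentiable at x" "\<And>y. y \<in> S \<Longrightarrow> g y = f y"
  shows "(g has_derivative frechet_derivative f (at x)) (at x)"
    and "frechet_derivative g (at x) = frechet_derivative f (at x)"
proof -
  have "(f has_derivative frechet_derivative f (at x)) (at x)"
    using assms(3) frechet_derivative_works by blast
  then show *: "(g has_derivative frechet_derivative f (at x)) (at x)"
    by (rule has_derivative_transform_within_open[OF _ assms(1,2)]) (simp add: assms(4))
  show "frechet_derivative g (at x) = frechet_derivative f (at x)"
    using frechet_derivative_at[OF *] by simp
qed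

lemma times_differentiable_on_cong:
  assumes "open S" "times_differentiable_on k S f" "\<And>x. x \<in> S \<Longrightarrow> g x = f x"
  shows "times_differentiable_on k S g"
  using assms(2,3)
proof (induction k arbitrary: f g)
  case 0
  then show ?case using continuous_on_cong[of S S g f] by simp
next
  case (Suc k)
  have "f differentiable at x" if "x \<in> S" for x
    using Suc.prems(1) that by simp
  note g = frechet_derivative_cong_open[OF \<open>open S\<close> _ this Suc.prems(2)]
  have "times_differentiable_on k S (\<lambda>x. frechet_derivative g (at x) v)" for v
  proof (rule Suc.IH)
    show "times_differentiable_on k S (\<lambda>x. frechet_derivative f (at x) v)"
      using Suc.prems(1) by simp
  qed (simp add: g(2))
  then show ?case using g(1) by (auto intro: differentiableI)
qed

lemma times_differentiable_on_SucD:
  "times_differentiable_on (Suc k) S f \<Longrightarrow> times_differentiable_on k S f"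
proof (induction k arbitrary: f)
  case 0
  then show ?case
    using continuous_at_imp_continuous_on differentiable_imp_continuous_within by fastforce
next
  case (Suc k)
  have "times_differentiable_on k S (\<lambda>x. frechet_derivative f (at x) v)" for v
    using Suc.prems by (intro Suc.IH) simp
  then show ?case using Suc.prems by simp
qed

lemma times_differentiable_on_add:
  assumes "open S" "times_differentiable_on k S f" "times_differentiable_on k S g"
  shows "times_differentiable_on k S (\<lambda>x. f x + g x)"
  using assms(2,3)
proof (induction k arbitrary: f g)
  case 0
  then show ?case by (simp add: continuous_on_add)
next
  case (Suc k)
  have D: "((\<lambda>x. f x + g x) has_derivative
      (\<lambda>v. frechet_derivative f (at x) v + frechet_derivative g (at x) v)) (at x)"
    if "x \<in> S" for x
    using Suc.prems that by (intro has_derivative_add) (auto simp flip: frechet_derivative_works)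
  have "times_differentiable_on k S (\<lambda>x. frechet_derivative (\<lambda>x. f x + g x) (at x) v)" for v
    by (rule times_differentiable_on_cong[OF \<open>open S\<close> Suc.IH
          [of "\<lambda>x. frechet_derivative f (at x) v" "\<lambda>x. frechet_derivative g (at x) v"]])
      (use Suc.prems in \<open>auto simp flip: frechet_derivative_at[OF D]\<close>)
  then show ?case
    using D by (auto simp: differentiable_def)
qed

text \<open>An arbitrary bounded bilinear \<open>h\<close> covers scalar multiplication and the
  inner product at once. Each term of the product rule differentiates one factor only;
  \<open>times_differentiable_on_SucD\<close> lowers the order of the other, so that the induction
  hypothesis applies.\<close>

lemma times_differentiable_on_bilinear:
  assumes "open S" and h: "bounded_bilinear h"
    and "times_differentiable_on k S f" "times_differentiable_on k S g"
  shows "times_differentiable_on k S (\<lambda>x. h (f x) (g x))"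
  using assms(3,4)
proof (induction k arbitrary: f g)
  case 0
  then show ?case by (simp add: bounded_bilinear.continuous_on[OF h])
next
  case (Suc k)
  have D: "((\<lambda>x. h (f x) (g x)) has_derivative
      (\<lambda>v. h (f x) (frechet_derivative g (at x) v) + h (frechet_derivative f (at x) v) (g x))) (at x)"
    if "x \<in> S" for x
    using Suc.prems that
    by (intro bounded_bilinear.FDERIV[OF h]) (auto simp flip: frechet_derivative_works)
  have "times_differentiable_on k S (\<lambda>x. frechet_derivative (\<lambda>x. h (f x) (g x)) (at x) v)" for v
  proof (rule times_differentiable_on_cong[OF \<open>open S\<close> times_differentiable_on_add[OF \<open>open S\<close>]])
    show "times_differentiable_on k S (\<lambda>x. h (f x) (frechet_derivative g (at x) v))"
      "times_differentiable_on k S (\<lambda>x. h (frechet_derivative f (at x) v) (g x))"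
      using Suc.prems by (auto intro!: Suc.IH intro: times_differentiable_on_SucD)
  qed (simp flip: frechet_derivative_at[OF D])
  then show ?case
    using D by (auto simp: differentiable_def)
qed

lemma times_differentiable_on_const: "times_differentiable_on k S (\<lambda>x. c)"
  by (induction k arbitrary: c) auto

lemma smooth_on_cong: "open S \<Longrightarrow> smooth_on S f \<Longrightarrow> (\<And>x. x \<in> S \<Longrightarrow> g x = f x) \<Longrightarrow> smooth_on S g"
  unfolding smooth_on_def by (auto elim: times_differentiable_on_cong)

lemma smooth_on_const: "smooth_on S (\<lambda>x. c)"
  by (simp add: smooth_on_def times_differentiable_on_const)

lemma smooth_on_add: "open S \<Longrightarrow> smooth_on S f \<Longrightarrow> smooth_on S g \<Longrightarrow> smooth_on S (\<lambda>x. f x + g x)"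
  unfolding smooth_on_def by (blast intro: times_differentiable_on_add)

lemma smooth_on_bilinear:
  "open S \<Longrightarrow> bounded_bilinear h \<Longrightarrow> smooth_on S f \<Longrightarrow> smooth_on S g \<Longrightarrow> smooth_on S (\<lambda>x. h (f x) (g x))"
  unfolding smooth_on_def by (simp add: times_differentiable_on_bilinear)

lemma smooth_on_scaleR:
  "open S \<Longrightarrow> smooth_on S f \<Longrightarrow> smooth_on S g \<Longrightarrow> smooth_on S (\<lambda>x. f x *\<^sub>R g x)"
  by (rule smooth_on_bilinear[OF _ bounded_bilinear_scaleR])

lemma smooth_on_diff:
  fixes f g :: "_ \<Rightarrow> 'b::real_normed_vector"
  assumes "open S" "smooth_on S f" "smooth_on S g"
  shows "smooth_on S (\<lambda>x. f x - g x)"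
  using smooth_on_add[OF assms(1,2) smooth_on_scaleR[OF assms(1) smooth_on_const[of S "-1"] assms(3)]]
  by simp

lemma smooth_on_sum:
  assumes "open S" "finite A" "\<And>i. i \<in> A \<Longrightarrow> smooth_on S (f i)"
  shows "smooth_on S (\<lambda>x. \<Sum>i\<in>A. f i x)"
  using assms(2,3) by (induction A) (simp_all add: smooth_on_const smooth_on_add assms(1))

lemma smooth_on_imp_differentiable: "smooth_on S f \<Longrightarrow> x \<in> S \<Longrightarrow> f differentiable at x"
  unfolding smooth_on_def by (drule spec[of _ "Suc 0"]) simp

lemma smooth_on_has_derivative:
  "smooth_on S f \<Longrightarrow> x \<in> S \<Longrightarrow> (f has_derivative frechet_derivative f (at x)) (at x)"
  by (simp add: smooth_on_imp_differentiable flip: frechet_derivative_works)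

lemma smooth_on_imp_continuous_on: "smooth_on S f \<Longrightarrow> continuous_on S f"
  unfolding smooth_on_def by (drule spec[of _ 0]) simp

lemma smooth_on_frechet_derivative_const:
  "smooth_on S f \<Longrightarrow> smooth_on S (\<lambda>x. frechet_derivative f (at x) v)"
  unfolding smooth_on_def
proof
  fix k assume "\<forall>k. times_differentiable_on k S f"
  then have "times_differentiable_on (Suc k) S f" ..
  then show "times_differentiable_on k S (\<lambda>x. frechet_derivative f (at x) v)" by simp
qed

lemma linear_sum_Basis:
  fixes L :: "'a::euclidean_space \<Rightarrow> 'b::real_vector"
  assumes "linear L"
  shows "L v = (\<Sum>b\<in>Basis. (v \<bullet> b) *\<^sub>R L b)"
proof -
  have "L v = L (\<Sum>b\<in>Basis. (v \<bullet> b) *\<^sub>R b)" by (simp add: euclidean_representation)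
  also have "\<dots> = (\<Sum>b\<in>Basis. (v \<bullet> b) *\<^sub>R L b)"
    using assms by (simp add: linear_sum linear_scale)
  finally show ?thesis .
qed

lemma frechet_derivative_sum_Basis:
  assumes "smooth_on S f" "x \<in> S"
  shows "frechet_derivative f (at x) v = (\<Sum>b\<in>Basis. (v \<bullet> b) *\<^sub>R frechet_derivative f (at x) b)"
  using assms by (intro linear_sum_Basis linear_frechet_derivative smooth_on_imp_differentiable)

text \<open>\<open>smooth_on\<close> speaks only of derivatives in a constant direction. Expanding
  \<open>X x\<close> in the basis moves the varying direction into scalar coefficients.\<close>

lemma smooth_on_frechet_derivative:
  fixes f :: "'a::euclidean_space \<Rightarrow> 'b::real_normed_vector"
  assumes "open S" "smooth_on S f" "smooth_on S X"
  shows "smooth_on S (\<lambda>x. frechet_derivative f (at x) (X x))"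
proof (rule smooth_on_cong[OF \<open>open S\<close> smooth_on_sum[OF \<open>open S\<close> finite_Basis]])
  show "smooth_on S (\<lambda>x. (X x \<bullet> b) *\<^sub>R frechet_derivative f (at x) b)" for b
    using assms by (intro smooth_on_scaleR smooth_on_frechet_derivative_const
        smooth_on_bilinear[of S "(\<bullet>)", OF _ bounded_bilinear_inner] smooth_on_const)
qed (rule frechet_derivative_sum_Basis[OF assms(2)])

lemma smooth_on_vf_apply: "open S \<Longrightarrow> smooth_on S X \<Longrightarrow> smooth_on S u \<Longrightarrow> smooth_on S (vf_apply X u)"
  unfolding vf_apply_def [abs_def] by (rule smooth_on_frechet_derivative)

lemma smooth_on_lie_bracket:
  "open S \<Longrightarrow> smooth_on S X \<Longrightarrow> smooth_on S Y \<Longrightarrow> smooth_on S (lie_bracket X Y)"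
  unfolding lie_bracket_def [abs_def] by (intro smooth_on_diff smooth_on_frechet_derivative)

lemma smooth_on_lie_module:
  assumes "open S" "\<And>X. X \<in> G \<Longrightarrow> smooth_on S X" "Z \<in> lie_module S G"
  shows "smooth_on S Z"
  using assms(3)
proof induction
  case (cong X X')
  then show ?case using smooth_on_cong[OF \<open>open S\<close>, of X X'] by simp
qed (simp_all add: assms(1,2) smooth_on_const smooth_on_add smooth_on_scaleR smooth_on_lie_bracket)

text \<open>Mean value inequality on the convex set \<open>K\<close>: the operator norm of the
  derivative is controlled by the finitely many partial derivatives, each continuous and hence
  bounded on \<open>K\<close>.\<close>

lemma smooth_on_lipschitz:
  fixes f :: "'a::euclidean_space \<Rightarrow> 'b::real_normed_vector"
  assumes "smooth_on S f" "compact K" "convex K" "K \<subseteq> S"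
  obtains L where "L-lipschitz_on K f"
proof -
  have "\<exists>B. \<forall>x\<in>K. norm (frechet_derivative f (at x) b) \<le> B" for b
    using compact_imp_bounded[OF compact_continuous_image[OF continuous_on_subset[OF
      smooth_on_imp_continuous_on[OF smooth_on_frechet_derivative_const[OF assms(1), of b]]
      \<open>K \<subseteq> S\<close>] \<open>compact K\<close>]]
    by (auto simp: bounded_iff)
  then obtain B where B: "\<And>b x. x \<in> K \<Longrightarrow> norm (frechet_derivative f (at x) b) \<le> B b"
    by metis
  define L where "L = (\<Sum>b\<in>Basis. \<bar>B b\<bar>)"
  have "norm (frechet_derivative f (at x) v) \<le> L * norm v" if "x \<in> K" for x v
  proof -
    have "norm (frechet_derivative f (at x) v)
        \<le> (\<Sum>b\<in>Basis. norm ((v \<bullet> b) *\<^sub>R frechet_derivative f (at x) b))"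
      using that \<open>K \<subseteq> S\<close>
      by (subst frechet_derivative_sum_Basis[OF assms(1)]) (blast, rule norm_sum)
    also have "\<dots> \<le> (\<Sum>b\<in>Basis. \<bar>B b\<bar> * norm v)"
    proof (rule sum_mono)
      fix b :: 'a assume "b \<in> Basis"
      then have "\<bar>v \<bullet> b\<bar> * norm (frechet_derivative f (at x) b) \<le> norm v * \<bar>B b\<bar>"
        using B[OF that, of b] Basis_le_norm[of b v] by (intro mult_mono) auto
      then show "norm ((v \<bullet> b) *\<^sub>R frechet_derivative f (at x) b) \<le> \<bar>B b\<bar> * norm v"
        by (simp add: mult.commute)
    qed
    finally show ?thesis by (simp add: L_def sum_distrib_right)
  qed
  note bound = this
  have "L \<ge> 0" by (simp add: L_def sum_nonneg)
  have "L-lipschitz_on K f"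
  proof (rule bounded_derivative_imp_lipschitz)
    fix x assume "x \<in> K"
    then show "(f has_derivative frechet_derivative f (at x)) (at x within K)"
      using \<open>K \<subseteq> S\<close> by (blast intro: has_derivative_at_withinI smooth_on_has_derivative[OF assms(1)])
    show "onorm (frechet_derivative f (at x)) \<le> L"
      by (rule onorm_bound[OF \<open>L \<ge> 0\<close> bound[OF \<open>x \<in> K\<close>]])
  qed fact+
  then show ?thesis ..
qed

lemma vf_apply_diff:
  assumes "smooth_on S u" "smooth_on S v" "x \<in> S"
  shows "vf_apply X (\<lambda>x. u x - v x) x = vf_apply X u x - vf_apply X v x"
proof -
  have "((\<lambda>x. u x - v x) has_derivative
      (\<lambda>h. frechet_derivative u (at x) h - frechet_derivative v (at x) h)) (at x)"
    using assms by (intro has_derivative_diff smooth_on_has_derivative)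
  from frechet_derivative_at[OF this] show ?thesis by (simp add: vf_apply_def fun_eq_iff)
qed

lemma vf_apply_cong:
  assumes "open S" "smooth_on S u" "x \<in> S" "\<And>y. y \<in> S \<Longrightarrow> v y = u y"
  shows "vf_apply X v x = vf_apply X u x"
  unfolding vf_apply_def
  using frechet_derivative_cong_open(2)[OF assms(1,3) smooth_on_imp_differentiable[OF assms(2,3)], of v]
    assms(4) by simp

section \<open>Closed sets and tangent fields\<close>

text \<open>The open ball about \<open>y\<close> has \<open>z\<close> on its boundary, so
  \<open>y - z\<close> is an exterior normal in the sense of Bony; points of \<open>F\<close>
  without such a ball impose no condition. Equality with 0, not an inequality, makes the property
  stable under multiplication by functions of any sign. The case \<open>y = z\<close> is harmless:
  the ball is empty and the product is 0.\<close>

definition tangent_to :: "'a::euclidean_space set \<Rightarrow> ('a \<Rightarrow> 'a) \<Rightarrow> bool" where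
  "tangent_to F X \<longleftrightarrow> (\<forall>z\<in>F. \<forall>y. ball y (dist y z) \<inter> F = {} \<longrightarrow> (y - z) \<bullet> X z = 0)"

lemma tangent_toD: "tangent_to F X \<Longrightarrow> z \<in> F \<Longrightarrow> ball y (dist y z) \<inter> F = {} \<Longrightarrow> (y - z) \<bullet> X z = 0"
  by (simp add: tangent_to_def)

lemma tangent_to_minus: "tangent_to F X \<Longrightarrow> tangent_to F (\<lambda>x. - X x)"
  by (simp add: tangent_to_def)

section \<open>One-sided differential inequalities and the distance to a closed set\<close>

text \<open>Phrased with right difference bounds because it is meant for squared distances, which
  need not be differentiable. With slack \<open>\<epsilon>\<close> in the slope, the bound
  \<open>g t \<le> g a + \<epsilon> * (t - a)\<close> cannot end at some \<open>c < b\<close>: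
  closedness carries it to \<open>c\<close>, and the Dini bound carries it past
  \<open>c\<close>.\<close>

lemma right_Dini_nonincreasing:
  fixes g :: "real \<Rightarrow> real"
  assumes "a \<le> b" "continuous_on {a..b} g"
    and Dini: "\<And>t \<epsilon>. t \<in> {a..<b} \<Longrightarrow> \<epsilon> > 0 \<Longrightarrow> eventually (\<lambda>s. g s \<le> g t + \<epsilon> * (s - t)) (at_right t)"
  shows "g b \<le> g a"
proof (cases "a = b")
  case False
  with \<open>a \<le> b\<close> have "a < b" by simp
  have "g b \<le> g a + \<epsilon> * (b - a)" if "\<epsilon> > 0" for \<epsilon>
  proof -
    define A where "A = {t \<in> {a..b}. g t - \<epsilon> * (t - a) \<le> g a}"
    define S where "S = {t \<in> {a..b}. {a..t} \<subseteq> A}"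
    define c where "c = Sup S"
    have aS: "a \<in> S" using \<open>a \<le> b\<close> by (auto simp: S_def A_def)
    have bdd: "bdd_above S" by (auto simp: S_def intro: bdd_aboveI[of _ b])
    have "c \<in> {a..b}"
      unfolding c_def atLeastAtMost_iff
    proof
      show "a \<le> Sup S" by (rule cSup_upper[OF aS bdd])
      show "Sup S \<le> b" using aS by (intro cSup_least) (auto simp: S_def)
    qed
    have below: "t \<in> A" if "a \<le> t" "t < c" for t
    proof -
      obtain s where "s \<in> S" "t < s"
        using less_cSupD[of S t] aS \<open>t < c\<close> unfolding c_def by blast
      with \<open>a \<le> t\<close> show ?thesis by (auto simp: S_def)
    qed
    have "closed A"
    proof -
      have "continuous_on {a..b} (\<lambda>t. g t - \<epsilon> * (t - a))"
        by (intro continuous_intros assms(2))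
      then show ?thesis
        unfolding A_def by (rule continuous_on_closed_Collect_le) auto
    qed
    have cA: "c \<in> A"
    proof (cases "c = a")
      case False
      with \<open>c \<in> {a..b}\<close> have "a < c" by simp
      have "{a..<c} \<subseteq> A" using below by auto
      then have "closure {a..<c} \<subseteq> A" using \<open>closed A\<close> by (rule closure_minimal)
      then have "{a..c} \<subseteq> A" using \<open>a < c\<close> by simp
      from subsetD[OF this, of c] show ?thesis using \<open>a < c\<close> by simp
    qed (use aS in \<open>auto simp: S_def\<close>)
    have "c = b"
    proof (rule ccontr)
      assume "c \<noteq> b"
      then have "c \<in> {a..<b}" using \<open>c \<in> {a..b}\<close> by simp
      from Dini[OF this \<open>\<epsilon> > 0\<close>] obtain d where d: "d > c" "\<And>s. c < s \<Longrightarrow> s < d \<Longrightarrow> g s \<le> g c + \<epsilon> * (s - c)"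
        by (auto simp: eventually_at_right_field)
      define s where "s = min b ((c + d) / 2)"
      have s: "c < s" "s < d" "s \<le> b" using d(1) \<open>c \<in> {a..<b}\<close> by (auto simp: s_def min_def)
      have "{a..s} \<subseteq> A"
      proof
        fix t assume t: "t \<in> {a..s}"
        show "t \<in> A"
        proof (cases "t < c")
          case False
          then have "g t \<le> g c + \<epsilon> * (t - c)" using d(2)[of t] t s by (cases "t = c") auto
          then show ?thesis using cA t s by (auto simp: A_def algebra_simps)
        qed (use below t in auto)
      qed
      then have "s \<in> S" using s \<open>c \<in> {a..b}\<close> by (auto simp: S_def)
      then have "s \<le> c" using bdd by (simp add: c_def cSup_upper)
      then show False using s by simp
    qed
    with cA show ?thesis by (simp add: A_def)
  qed
  from this[of "e / (b - a)" for e] have "g b \<le> g a + e" if "e > 0" for e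
    using that \<open>a < b\<close> by simp
  then show ?thesis by (rule field_le_epsilon)
qed simp

text \<open>The integrating factor \<open>exp (- L * t)\<close> removes the term
  \<open>L * D t\<close>, and subtracting \<open>c * t\<close> absorbs \<open>c\<close> because that
  factor is at most 1.\<close>

lemma Gronwall_Dini:
  fixes D :: "real \<Rightarrow> real"
  assumes "T \<ge> 0" "continuous_on {0..T} D" "L \<ge> 0" "c \<ge> 0"
    and Dini: "\<And>t \<epsilon>. t \<in> {0..<T} \<Longrightarrow> \<epsilon> > 0 \<Longrightarrow>
      eventually (\<lambda>s. D s \<le> D t + (L * D t + c + \<epsilon>) * (s - t)) (at_right t)"
  shows "D T \<le> exp (L * T) * (D 0 + c * T)"
proof -
  define g where "g t = exp (- L * t) * D t - c * t" for t
  have "g T \<le> g 0"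
  proof (rule right_Dini_nonincreasing[OF \<open>T \<ge> 0\<close>])
    show "continuous_on {0..T} g"
      unfolding g_def by (intro continuous_intros assms(2))
    fix t \<epsilon> :: real assume t: "t \<in> {0..<T}" and "\<epsilon> > 0"
    \<comment> \<open>\<open>h\<close> is a differentiable majorant of \<open>g\<close> just to the
      right of \<open>t\<close> that touches it at \<open>t\<close>. Its slope there is at most
      \<open>\<epsilon> / 2\<close>; the other half of \<open>\<epsilon>\<close> gives the strict
      inequality for difference quotients.\<close>
    define h where "h s = exp (- L * s) * (D t + (L * D t + c + \<epsilon> / 2) * (s - t)) - c * s" for s
    have "(h has_real_derivative exp (- L * t) * (c + \<epsilon> / 2) - c) (at t)"
      unfolding h_def by (auto intro!: derivative_eq_intros simp: algebra_simps)
    then have "((\<lambda>s. (h s - h t) / (s - t)) \<longlongrightarrow> exp (- L * t) * (c + \<epsilon> / 2) - c) (at_right t)"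
      by (auto simp: has_field_derivative_iff intro: tendsto_mono at_le)
    moreover have "exp (- L * t) * (c + \<epsilon> / 2) - c < \<epsilon>"
    proof -
      have "exp (- L * t) * (c + \<epsilon> / 2) \<le> 1 * (c + \<epsilon> / 2)"
        using t \<open>L \<ge> 0\<close> \<open>c \<ge> 0\<close> \<open>\<epsilon> > 0\<close> by (intro mult_right_mono) auto
      then show ?thesis using \<open>\<epsilon> > 0\<close> by simp
    qed
    ultimately have "eventually (\<lambda>s. (h s - h t) / (s - t) < \<epsilon>) (at_right t)"
      by (rule order_tendstoD)
    moreover have "eventually (\<lambda>s. D s \<le> D t + (L * D t + c + \<epsilon> / 2) * (s - t)) (at_right t)"
      using Dini[OF t, of "\<epsilon> / 2"] \<open>\<epsilon> > 0\<close> by simp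
    moreover have "eventually (\<lambda>s. s > t) (at_right t)"
      by (simp add: eventually_at_right_less)
    ultimately show "eventually (\<lambda>s. g s \<le> g t + \<epsilon> * (s - t)) (at_right t)"
    proof eventually_elim
      case (elim s)
      have "g s \<le> h s" unfolding g_def h_def using elim(2) by simp
      moreover have "h t = g t" by (simp add: g_def h_def)
      moreover have "h s - h t < \<epsilon> * (s - t)" using elim(1,3) by (simp add: divide_less_eq)
      ultimately show ?case by simp
    qed
  qed
  then have "exp (- L * T) * D T \<le> D 0 + c * T" by (simp add: g_def)
  then have "exp (L * T) * (exp (- L * T) * D T) \<le> exp (L * T) * (D 0 + c * T)" by simp
  then show ?thesis by (simp flip: exp_add mult.assoc)
qed

text \<open>At a nearest point \<open>z\<close> of \<open>F\<close> the vector
  \<open>\<gamma> t - z\<close> is an exterior normal, so \<open>X z\<close> contributes nothing to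
  the derivative of the squared distance. What remains is the variation of \<open>X\<close> between
  \<open>z\<close> and \<open>\<gamma> t\<close>, controlled by the Lipschitz constant, and the
  error \<open>\<eta>\<close>. Keeping the curve within \<open>\<rho>\<close> of \<open>x0\<close>
  keeps nearest points within \<open>2 * \<rho>\<close>.\<close>

lemma near_invariance:
  fixes X :: "'a::euclidean_space \<Rightarrow> 'a"
  assumes comp: "compact (F \<inter> cball x0 (2 * \<rho>))" and "x0 \<in> F" and "\<rho> > 0"
    and tan: "tangent_to F X" and lip: "K-lipschitz_on (cball x0 (2 * \<rho>)) X"
    and "T > 0" "\<eta> \<ge> 0" and start: "\<gamma> 0 \<in> F"
    and ball: "\<And>s. s \<in> {0..T} \<Longrightarrow> dist x0 (\<gamma> s) < \<rho>"
    and der: "\<And>s. s \<in> {0..T} \<Longrightarrow> (\<gamma> has_vector_derivative \<gamma>' s) (at s within {0..T})"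
    and err: "\<And>s. s \<in> {0..T} \<Longrightarrow> norm (\<gamma>' s - X (\<gamma> s)) \<le> \<eta>"
  shows "infdist (\<gamma> T) (F \<inter> cball x0 (2 * \<rho>)) \<le> exp (K * T + 1) * \<eta> * T"
proof -
  define F' where "F' = F \<inter> cball x0 (2 * \<rho>)"
  have F': "compact F'" "F' \<noteq> {}" "x0 \<in> F'"
    using comp \<open>x0 \<in> F\<close> \<open>\<rho> > 0\<close> by (auto simp: F'_def)
  have "K \<ge> 0" using lip by (rule lipschitz_on_nonneg)
  define D where "D t = (infdist (\<gamma> t) F')\<^sup>2" for t
  have cont: "continuous_on {0..T} \<gamma>"
    by (rule continuous_on_vector_derivative[OF der])
  have "D T \<le> exp ((2 * K + 1 / T) * T) * (D 0 + T * \<eta>\<^sup>2 * T)"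
  proof (rule Gronwall_Dini)
    show "continuous_on {0..T} D"
      unfolding D_def by (intro continuous_intros cont)
    fix t \<epsilon> :: real assume t: "t \<in> {0..<T}" and "\<epsilon> > 0"
    then have tT: "t \<in> {0..T}" by simp
    obtain z where z: "z \<in> F'" "infdist (\<gamma> t) F' = dist (\<gamma> t) z"
      using infdist_attains_inf[of F' "\<gamma> t"] F' compact_imp_closed by blast
    have "dist (\<gamma> t) z \<le> dist (\<gamma> t) x0"
      using infdist_le[OF F'(3), of "\<gamma> t"] z by simp
    then have dz: "dist (\<gamma> t) z < \<rho>" using ball[OF tT] by (simp add: dist_commute)
    \<comment> \<open>Cutting \<open>F\<close> down to \<open>F'\<close> creates no false nearest
      points: a point of \<open>F\<close> closer than \<open>z\<close> lies within
      \<open>2 * \<rho>\<close> of \<open>x0\<close>, hence in \<open>F'\<close>.\<close>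
    have "ball (\<gamma> t) (dist (\<gamma> t) z) \<inter> F = {}"
    proof (rule ccontr)
      assume "\<not> ?thesis"
      then obtain f where f: "f \<in> F" "dist (\<gamma> t) f < dist (\<gamma> t) z" by auto
      have "dist x0 f \<le> dist x0 (\<gamma> t) + dist (\<gamma> t) f" by (rule dist_triangle)
      then have "f \<in> F'" using f dz ball[OF tT] by (simp add: F'_def)
      then show False using infdist_le[of f F' "\<gamma> t"] f z by simp
    qed
    then have perp: "(\<gamma> t - z) \<bullet> X z = 0"
      using tangent_toD[OF tan] z(1) by (simp add: F'_def)
    have zb: "z \<in> cball x0 (2 * \<rho>)" and gb: "\<gamma> t \<in> cball x0 (2 * \<rho>)"
      using z ball[OF tT] \<open>\<rho> > 0\<close> by (auto simp: F'_def)
    have Dt: "D t = (norm (\<gamma> t - z))\<^sup>2" by (simp add: D_def z dist_norm)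
    define N where "N = norm (\<gamma> t - z)"
    have "(\<gamma> t - z) \<bullet> \<gamma>' t = (\<gamma> t - z) \<bullet> (X (\<gamma> t) - X z) + (\<gamma> t - z) \<bullet> (\<gamma>' t - X (\<gamma> t))"
      using perp by (simp add: inner_diff_right)
    also have "\<dots> \<le> N * (K * N) + N * \<eta>"
    proof (rule add_mono)
      have "norm (X (\<gamma> t) - X z) \<le> K * N"
        using lipschitz_onD[OF lip gb zb] by (simp add: dist_norm N_def)
      then show "(\<gamma> t - z) \<bullet> (X (\<gamma> t) - X z) \<le> N * (K * N)"
        unfolding N_def by (intro order_trans[OF norm_cauchy_schwarz] mult_left_mono) simp_all
      show "(\<gamma> t - z) \<bullet> (\<gamma>' t - X (\<gamma> t)) \<le> N * \<eta>"
        unfolding N_def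
        by (rule order_trans[OF norm_cauchy_schwarz mult_left_mono[OF err[OF tT] norm_ge_zero]])
    qed
    finally have "2 * ((\<gamma> t - z) \<bullet> \<gamma>' t) \<le> 2 * (K * N\<^sup>2) + 2 * N * \<eta>"
      by (simp add: power2_eq_square algebra_simps)
    txt \<open>The weight \<open>1 / T\<close> costs only a factor \<open>exp 1\<close> in the Gronwall bound and yields a distance of order
      \<open>\<eta> * T\<close>; splitting with weight 1 would give only \<open>\<eta> * sqrt T\<close>.\<close>
    also have "2 * N * \<eta> \<le> N\<^sup>2 / T + T * \<eta>\<^sup>2"
    proof -
      have "0 \<le> (N - T * \<eta>)\<^sup>2 / T" using \<open>T > 0\<close> by simp
      also have "\<dots> = N\<^sup>2 / T - 2 * N * \<eta> + T * \<eta>\<^sup>2"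
        using \<open>T > 0\<close> by (simp add: power2_eq_square field_simps)
      finally show ?thesis by simp
    qed
    finally have slope: "2 * ((\<gamma> t - z) \<bullet> \<gamma>' t) < (2 * K + 1 / T) * D t + T * \<eta>\<^sup>2 + \<epsilon>"
      using \<open>\<epsilon> > 0\<close> by (simp add: Dt N_def algebra_simps)
    \<comment> \<open>The squared distance to the fixed point \<open>z\<close> lies above
      \<open>D\<close> and agrees with it at \<open>t\<close>, so its slope yields the right Dini
      bound even where \<open>D\<close> is not differentiable.\<close>
    define h where "h s = (\<gamma> s - z) \<bullet> (\<gamma> s - z)" for s
    have right: "at_right t = at t within {t<..T}"
      using t by (intro at_within_nhd[of t "{..<T}"]) auto
    have "(\<gamma> has_vector_derivative \<gamma>' t) (at_right t)"
      unfolding right by (rule has_vector_derivative_within_subset[OF der[OF tT]]) (use t in auto)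
    then have "(h has_real_derivative 2 * ((\<gamma> t - z) \<bullet> \<gamma>' t)) (at_right t)"
      unfolding h_def has_field_derivative_def has_vector_derivative_def
      by (auto intro!: derivative_eq_intros simp: fun_eq_iff inner_commute algebra_simps)
    then have "((\<lambda>s. (h s - h t) / (s - t)) \<longlongrightarrow> 2 * ((\<gamma> t - z) \<bullet> \<gamma>' t)) (at_right t)"
      by (simp add: has_field_derivative_iff)
    from order_tendstoD(2)[OF this slope]
    have "eventually (\<lambda>s. (h s - h t) / (s - t) < (2 * K + 1 / T) * D t + T * \<eta>\<^sup>2 + \<epsilon>) (at_right t)" .
    moreover have "eventually (\<lambda>s. s > t) (at_right t)"
      by (simp add: eventually_at_right_less)
    ultimately show "eventually (\<lambda>s. D s \<le> D t + ((2 * K + 1 / T) * D t + T * \<eta>\<^sup>2 + \<epsilon>) * (s - t)) (at_right t)"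
    proof eventually_elim
      case (elim s)
      have "D s \<le> h s"
        unfolding D_def h_def power2_norm_eq_inner[symmetric] using infdist_le[OF z(1), of "\<gamma> s"]
        by (intro power_mono) (auto simp: dist_norm infdist_nonneg)
      moreover have "h t = D t" by (simp add: h_def Dt power2_norm_eq_inner)
      moreover have "h s - h t \<le> ((2 * K + 1 / T) * D t + T * \<eta>\<^sup>2 + \<epsilon>) * (s - t)"
        using elim by (simp add: divide_less_eq)
      ultimately show ?case by simp
    qed
  qed (use \<open>T > 0\<close> \<open>K \<ge> 0\<close> in auto)
  moreover have "D 0 = 0"
  proof -
    have "\<gamma> 0 \<in> F'" using start ball[of 0] \<open>T > 0\<close> \<open>\<rho> > 0\<close> by (simp add: F'_def)
    then show ?thesis by (simp add: D_def)
  qed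
  \<comment> \<open>The exponent is \<open>2 * K * T + 1\<close>, at most twice
    \<open>K * T + 1\<close>; a square is wanted so that a root can be taken in the end.\<close>
  moreover have exp_le: "exp ((2 * K + 1 / T) * T) \<le> (exp (K * T + 1))\<^sup>2"
    using \<open>T > 0\<close> by (simp add: algebra_simps flip: exp_double)
  moreover have "T * \<eta>\<^sup>2 * T = (\<eta> * T)\<^sup>2" by (simp add: power2_eq_square)
  ultimately have "D T \<le> exp ((2 * K + 1 / T) * T) * (\<eta> * T)\<^sup>2" by simp
  also have "\<dots> \<le> (exp (K * T + 1))\<^sup>2 * (\<eta> * T)\<^sup>2"
    using exp_le by (rule mult_right_mono) simp
  finally have "(infdist (\<gamma> T) F')\<^sup>2 \<le> (exp (K * T + 1) * \<eta> * T)\<^sup>2"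
    by (simp only: D_def power_mult_distrib mult.assoc)
  from power2_le_imp_le[OF this] show ?thesis
    using \<open>T > 0\<close> \<open>\<eta> \<ge> 0\<close> by (simp add: F'_def)
qed

section \<open>Commutators of approximate flows, and propagation along integral curves\<close>

lemma compact_Int_cball:
  fixes F :: "'a::euclidean_space set"
  assumes "closedin (top_of_set S) F" "cball x r \<subseteq> S"
  shows "compact (F \<inter> cball x r)"
proof -
  obtain C where "closed C" "F = S \<inter> C" using assms(1) by (auto simp: closedin_closed)
  moreover have "S \<inter> C \<inter> cball x r = C \<inter> cball x r" using assms(2) by auto
  ultimately show ?thesis by (simp add: closed_Int_compact)
qed

text \<open>This is \<open>p t = x + t v + t\<^sup>2 w + o(t\<^sup>2)\<close> as \<open>t\<close>
  decreases to 0, without a factor 1/2 at \<open>w\<close>. It describes a family of points; no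
  continuity in \<open>t\<close> is imposed, since nearest points may jump.\<close>

definition expands :: "(real \<Rightarrow> 'a::real_normed_vector) \<Rightarrow> 'a \<Rightarrow> 'a \<Rightarrow> 'a \<Rightarrow> bool" where
  "expands p x v w \<longleftrightarrow> ((\<lambda>t. (p t - x - t *\<^sub>R v) /\<^sub>R t\<^sup>2) \<longlongrightarrow> w) (at_right 0)"

text \<open>Follow \<open>X\<close> from \<open>p t\<close> for time \<open>t\<close>: at time
  \<open>s\<close> the field is \<open>X x + s D (X x) + t D v + o(t)\<close>, and integrating over
  \<open>{0..t}\<close> gives the new coefficients, the 1/2 coming from the integral of
  \<open>s\<close>. The point reached is within \<open>o(t\<^sup>2)\<close> of \<open>F\<close>, so
  moving it to a nearest point preserves the expansion and lets a further step start in
  \<open>F\<close>.\<close>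

lemma expands_step:
  fixes X :: "'a::euclidean_space \<Rightarrow> 'a"
  assumes "open S" and F: "closedin (top_of_set S) F" and tan: "tangent_to F X"
    and "smooth_on S X" and "x \<in> F" and D: "(X has_derivative D) (at x)"
    and p: "expands p x v w" and pF: "eventually (\<lambda>t. p t \<in> F) (at_right 0)"
  obtains q where "expands q x (v + X x) (w + D v + D (X x) /\<^sub>R 2)"
    and "eventually (\<lambda>t. q t \<in> F) (at_right 0)"
proof -
  have "x \<in> S" using F \<open>x \<in> F\<close> closedin_imp_subset by blast
  then obtain r where "r > 0" "cball x r \<subseteq> S"
    using \<open>open S\<close> open_contains_cball by blast
  define \<rho> where "\<rho> = r / 2"
  have \<rho>: "\<rho> > 0" "cball x (2 * \<rho>) \<subseteq> S" using \<open>r > 0\<close> \<open>cball x r \<subseteq> S\<close> by (auto simp: \<rho>_def)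
  define F' where "F' = F \<inter> cball x (2 * \<rho>)"
  have F': "compact F'" "x \<in> F'"
    using compact_Int_cball[OF F \<rho>(2)] \<open>x \<in> F\<close> \<rho> by (auto simp: F'_def)
  obtain K where K: "K-lipschitz_on (cball x (2 * \<rho>)) X"
    using smooth_on_lipschitz[OF \<open>smooth_on S X\<close> compact_cball convex_cball \<rho>(2)] .
  have "K \<ge> 0" using K by (rule lipschitz_on_nonneg)
  have "bounded_linear D" using D by (rule has_derivative_bounded_linear)
  then interpret D: bounded_linear D .
  obtain M where M: "M > 0" "\<And>h. norm (D h) \<le> norm h * M" using D.pos_bounded by blast

  txt \<open>With coefficients frozen at \<open>x\<close>, \<open>\<gamma> t\<close> is an integral curve of \<open>X\<close> on \<open>{0..t}\<close> up to an error \<open>o(t)\<close>,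
    and its endpoint \<open>\<gamma> t t\<close> has exactly the claimed expansion.\<close>
  define \<gamma> where "\<gamma> t s = p t + s *\<^sub>R (X x + t *\<^sub>R D v) + (s\<^sup>2 / 2) *\<^sub>R D (X x)" for t s
  define \<gamma>' where "\<gamma>' t s = X x + t *\<^sub>R D v + s *\<^sub>R D (X x)" for t s
  have der: "(\<gamma> t has_vector_derivative \<gamma>' t s) (at s within A)" for t s A
    unfolding \<gamma>_def \<gamma>'_def has_vector_derivative_def
    by (auto intro!: derivative_eq_intros simp: fun_eq_iff algebra_simps)

  define R where "R t = (p t - x - t *\<^sub>R v) /\<^sub>R t\<^sup>2" for t
  have R: "(R \<longlongrightarrow> w) (at_right 0)" using p by (simp add: R_def [abs_def] expands_def)
  define B where "B = norm w + 1"
  have evB: "eventually (\<lambda>t. norm (R t) < B) (at_right 0)"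
    using order_tendstoD(2)[OF tendsto_norm[OF R], of B] by (simp add: B_def)
  have p_eq: "p t = x + t *\<^sub>R v + t\<^sup>2 *\<^sub>R R t" if "t > 0" for t
    using that by (simp add: R_def)
  define C where "C = norm v + B + norm (X x) + norm (D v) + norm (D (X x)) + 1"
  have "C > 0" unfolding C_def B_def by (intro add_nonneg_pos add_nonneg_nonneg) simp_all
  have evpos: "eventually (\<lambda>t. t \<in> {0<..<d}) (at_right 0)" if "d > 0" for d :: real
    using that by (rule eventually_at_right_real)

  have dev: "norm (\<gamma> t s - x) \<le> C * t \<and> norm (\<gamma> t s - x - t *\<^sub>R v - s *\<^sub>R X x) \<le> C * t\<^sup>2"
    if t: "0 < t" "t < 1" "norm (R t) < B" and s: "s \<in> {0..t}" for t s
  proof -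
    have *: "\<gamma> t s - x - t *\<^sub>R v - s *\<^sub>R X x
        = t\<^sup>2 *\<^sub>R R t + (s * t) *\<^sub>R D v + (s\<^sup>2 / 2) *\<^sub>R D (X x)"
      using p_eq[OF t(1)] by (simp add: \<gamma>_def algebra_simps)
    have "norm (t\<^sup>2 *\<^sub>R R t) \<le> t\<^sup>2 * B" using t by (simp add: mult_left_mono)
    moreover have "norm ((s * t) *\<^sub>R D v) \<le> t\<^sup>2 * norm (D v)"
      using s t by (auto simp: power2_eq_square intro!: mult_right_mono)
    moreover have "norm ((s\<^sup>2 / 2) *\<^sub>R D (X x)) \<le> t\<^sup>2 * norm (D (X x))"
    proof -
      have "s\<^sup>2 \<le> t\<^sup>2" using s by (intro power_mono) auto
      then have "s\<^sup>2 / 2 \<le> t\<^sup>2" using zero_le_power2[of t] by linarith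
      from mult_right_mono[OF this norm_ge_zero[of "D (X x)"]] show ?thesis by simp
    qed
    ultimately have n2: "norm (\<gamma> t s - x - t *\<^sub>R v - s *\<^sub>R X x)
        \<le> t\<^sup>2 * (B + norm (D v) + norm (D (X x)))"
      unfolding * distrib_left by (intro norm_triangle_mono)
    also have "\<dots> \<le> t\<^sup>2 * C" by (intro mult_left_mono) (auto simp: C_def)
    finally have second: "norm (\<gamma> t s - x - t *\<^sub>R v - s *\<^sub>R X x) \<le> C * t\<^sup>2"
      by (simp add: mult.commute)
    have tt: "t\<^sup>2 \<le> t" using t by (simp add: power2_eq_square mult_left_le)
    have "norm (\<gamma> t s - x - t *\<^sub>R v - s *\<^sub>R X x + (t *\<^sub>R v + s *\<^sub>R X x))
        \<le> t * (B + norm (D v) + norm (D (X x))) + (t * norm v + t * norm (X x))"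
    proof (intro norm_triangle_mono)
      show "norm (\<gamma> t s - x - t *\<^sub>R v - s *\<^sub>R X x) \<le> t * (B + norm (D v) + norm (D (X x)))"
        by (rule order_trans[OF n2 mult_right_mono[OF tt]]) (simp add: B_def)
      show "norm (t *\<^sub>R v) \<le> t * norm v" "norm (s *\<^sub>R X x) \<le> t * norm (X x)"
        using s t by (simp_all add: mult_right_mono)
    qed
    also have "\<dots> \<le> C * t" using t by (simp add: C_def algebra_simps)
    finally have "norm (\<gamma> t s - x) \<le> C * t" by simp
    then show ?thesis using second by simp
  qed

  have err: "eventually (\<lambda>t. \<forall>s\<in>{0..t}. norm (\<gamma>' t s - X (\<gamma> t s)) \<le> \<epsilon> * t) (at_right 0)"
    if "\<epsilon> > 0" for \<epsilon>
  proof -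
    \<comment> \<open>Half of \<open>\<epsilon>\<close> pays for the Taylor remainder, whose
      argument has norm at most \<open>C * t\<close>; the other half pays for the image under
      \<open>D\<close> of the quadratic deviation, at most \<open>C * M * t\<^sup>2\<close>, once
      \<open>t < \<epsilon> / (2 * C * M)\<close>.\<close>
    define \<epsilon>' where "\<epsilon>' = \<epsilon> / (2 * C)"
    have "\<epsilon>' > 0" using \<open>\<epsilon> > 0\<close> \<open>C > 0\<close> by (simp add: \<epsilon>'_def)
    then obtain d where d: "d > 0"
      "\<And>y. norm (y - x) < d \<Longrightarrow> norm (X y - X x - D (y - x)) \<le> \<epsilon>' * norm (y - x)"
      using D unfolding has_derivative_at_alt by blast
    have "d / C > 0" "\<epsilon> / (2 * C * M) > 0" using d \<open>C > 0\<close> \<open>M > 0\<close> \<open>\<epsilon> > 0\<close> by simp_all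
    from evB evpos[OF zero_less_one] evpos[OF this(1)] evpos[OF this(2)]
    show ?thesis
    proof eventually_elim
      case (elim t)
      show ?case
      proof
        fix s assume s: "s \<in> {0..t}"
        note dev = dev[OF _ _ elim(1) s]
        have n: "norm (\<gamma> t s - x) \<le> C * t" "norm (\<gamma> t s - x - t *\<^sub>R v - s *\<^sub>R X x) \<le> C * t\<^sup>2"
          using dev elim by auto
        have "C * t < d" using elim(3) \<open>C > 0\<close> by (simp add: pos_less_divide_eq mult.commute)
        then have "norm (X (\<gamma> t s) - X x - D (\<gamma> t s - x)) \<le> \<epsilon>' * norm (\<gamma> t s - x)"
          using n by (intro d) simp
        also have "\<dots> \<le> \<epsilon>' * (C * t)" using n \<open>\<epsilon>' > 0\<close> by (intro mult_left_mono) auto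
        also have "\<dots> = \<epsilon> / 2 * t" using \<open>C > 0\<close> by (simp add: \<epsilon>'_def)
        finally have 1: "norm (X (\<gamma> t s) - X x - D (\<gamma> t s - x)) \<le> \<epsilon> / 2 * t" .
        have "norm (D (\<gamma> t s - x - t *\<^sub>R v - s *\<^sub>R X x)) \<le> C * t\<^sup>2 * M"
          using order_trans[OF M(2) mult_right_mono[OF n(2)]] \<open>M > 0\<close> by simp
        also have "\<dots> = (C * M * t) * t" by (simp add: power2_eq_square)
        also have "\<dots> \<le> \<epsilon> / 2 * t"
          using elim(4) \<open>C > 0\<close> \<open>M > 0\<close> by (intro mult_right_mono) (auto simp: field_simps)
        finally have 2: "norm (D (\<gamma> t s - x - t *\<^sub>R v - s *\<^sub>R X x)) \<le> \<epsilon> / 2 * t" .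
        have "\<gamma>' t s - X (\<gamma> t s) = - (X (\<gamma> t s) - X x - D (\<gamma> t s - x))
            - D (\<gamma> t s - x - t *\<^sub>R v - s *\<^sub>R X x)"
          by (simp add: \<gamma>'_def D.diff D.scaleR D.add)
        also have "norm \<dots> \<le> \<epsilon> / 2 * t + \<epsilon> / 2 * t"
          using 1 2 by (intro order_trans[OF norm_triangle_ineq4 add_mono]) (simp_all add: norm_minus_commute)
        finally show "norm (\<gamma>' t s - X (\<gamma> t s)) \<le> \<epsilon> * t" by simp
      qed
    qed
  qed

  have "\<exists>q\<in>F'. infdist (\<gamma> t t) F' = dist (\<gamma> t t) q" for t
    using infdist_attains_inf[of F' "\<gamma> t t"] F' compact_imp_closed by blast
  then obtain q where q: "\<And>t. q t \<in> F'" "\<And>t. infdist (\<gamma> t t) F' = dist (\<gamma> t t) (q t)"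
    by metis
  have near: "eventually (\<lambda>t. dist (\<gamma> t t) (q t) \<le> exp (K + 1) * \<epsilon> * t\<^sup>2) (at_right 0)"
    if "\<epsilon> > 0" for \<epsilon>
  proof -
    have "\<rho> / C > 0" using \<rho> \<open>C > 0\<close> by simp
    from evB evpos[OF zero_less_one] evpos[OF this] err[OF \<open>\<epsilon> > 0\<close>] pF
    show ?thesis
    proof eventually_elim
      case (elim t)
      have "C * t < \<rho>" using elim(3) \<open>C > 0\<close> by (simp add: pos_less_divide_eq mult.commute)
      \<comment> \<open>An error \<open>\<epsilon> * t\<close> over a time \<open>t\<close> costs a
        distance of order \<open>\<epsilon> * t\<^sup>2\<close>, which is the precision that
        \<open>expands\<close> demands.\<close>
      have "infdist (\<gamma> t t) F' \<le> exp (K * t + 1) * (\<epsilon> * t) * t"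
        unfolding F'_def
      proof (rule near_invariance[where \<gamma> = "\<gamma> t" and \<gamma>' = "\<gamma>' t",
            OF compact_Int_cball[OF F \<rho>(2)] \<open>x \<in> F\<close> \<rho>(1) tan K])
        show "\<gamma> t 0 \<in> F" using elim by (simp add: \<gamma>_def)
        show "dist x (\<gamma> t s) < \<rho>" if "s \<in> {0..t}" for s
          using dev[OF _ _ elim(1) that] elim(2) \<open>C * t < \<rho>\<close> by (simp add: dist_norm norm_minus_commute)
      qed (use der elim \<open>\<epsilon> > 0\<close> in auto)
      also have "\<dots> \<le> exp (K + 1) * (\<epsilon> * t) * t"
        using elim(2) \<open>\<epsilon> > 0\<close> \<open>K \<ge> 0\<close> by (intro mult_right_mono) (auto simp: mult_left_le)
      finally show ?case by (simp add: q(2) power2_eq_square mult.assoc)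
    qed
  qed
  have "((\<lambda>t. (q t - \<gamma> t t) /\<^sub>R t\<^sup>2) \<longlongrightarrow> 0) (at_right 0)"
  proof (rule tendstoI)
    fix \<epsilon> :: real assume "\<epsilon> > 0"
    define \<epsilon>' where "\<epsilon>' = \<epsilon> / (2 * exp (K + 1))"
    have "\<epsilon>' > 0" using \<open>\<epsilon> > 0\<close> by (simp add: \<epsilon>'_def)
    from near[OF this] evpos[OF zero_less_one]
    show "eventually (\<lambda>t. dist ((q t - \<gamma> t t) /\<^sub>R t\<^sup>2) 0 < \<epsilon>) (at_right 0)"
    proof eventually_elim
      case (elim t)
      have "norm (q t - \<gamma> t t) \<le> exp (K + 1) * \<epsilon>' * t\<^sup>2"
        using elim by (simp add: dist_norm norm_minus_commute)
      also have "\<dots> < \<epsilon> * t\<^sup>2" using elim \<open>\<epsilon> > 0\<close> by (simp add: \<epsilon>'_def)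
      finally have "norm (q t - \<gamma> t t) / t\<^sup>2 < \<epsilon>" using elim by (simp add: pos_divide_less_eq)
      then show ?case by (simp add: divide_inverse_commute)
    qed
  qed
  then have "((\<lambda>t. R t + D v + D (X x) /\<^sub>R 2 + (q t - \<gamma> t t) /\<^sub>R t\<^sup>2) \<longlongrightarrow> w + D v + D (X x) /\<^sub>R 2 + 0) (at_right 0)"
    by (intro tendsto_intros R)
  moreover have "eventually (\<lambda>t. R t + D v + D (X x) /\<^sub>R 2 + (q t - \<gamma> t t) /\<^sub>R t\<^sup>2
      = (q t - x - t *\<^sub>R (v + X x)) /\<^sub>R t\<^sup>2) (at_right 0)"
    using evpos[OF zero_less_one]
  proof eventually_elim
    case (elim t)
    have "q t - x - t *\<^sub>R (v + X x) = t\<^sup>2 *\<^sub>R (R t + D v + D (X x) /\<^sub>R 2) + (q t - \<gamma> t t)"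
      using elim p_eq[of t] by (simp add: \<gamma>_def power2_eq_square algebra_simps)
    then show ?case using elim by (simp only: scaleR_right_distrib[of "inverse (t\<^sup>2)"]) simp
  qed
  ultimately have "expands q x (v + X x) (w + D v + D (X x) /\<^sub>R 2)"
    unfolding expands_def add_0_right by (rule Lim_transform_eventually)
  then show ?thesis using q(1) by (intro that[of q]) (auto simp: F'_def)
qed

text \<open>Steps along \<open>X\<close>, \<open>Y\<close>, \<open>- X\<close>, \<open>- Y\<close>
  from \<open>z\<close>, each for time \<open>t\<close>: the first-order terms cancel and the
  coefficient of \<open>t\<^sup>2\<close> is \<open>lie_bracket X Y z\<close>. The points reached
  lie in \<open>F\<close>, hence outside the ball, so the bracket cannot point into it.\<close>

lemma tangent_to_lie_bracket:
  fixes X Y :: "'a::euclidean_space \<Rightarrow> 'a"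
  assumes "open S" and F: "closedin (top_of_set S) F"
    and X: "tangent_to F X" "smooth_on S X" and Y: "tangent_to F Y" "smooth_on S Y"
  shows "tangent_to F (lie_bracket X Y)"
proof -
  have neg: "smooth_on S (\<lambda>x. - W x)" if "smooth_on S W" for W :: "'a \<Rightarrow> 'a"
    using smooth_on_diff[OF \<open>open S\<close> smooth_on_const that, of 0] by simp
  \<comment> \<open>Staying outside the ball gives one sign only. Exchanging the fields reverses the
    bracket and gives the other, hence the fresh \<open>X\<close> and \<open>Y\<close> here.\<close>
  have le: "(y - z) \<bullet> lie_bracket X Y z \<le> 0"
    if X: "tangent_to F X" "smooth_on S X" and Y: "tangent_to F Y" "smooth_on S Y"
      and z: "z \<in> F" "ball y (dist y z) \<inter> F = {}" for X Y y z
  proof -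
    have "z \<in> S" using F z(1) closedin_imp_subset by blast
    note dX = smooth_on_has_derivative[OF X(2) this] and dY = smooth_on_has_derivative[OF Y(2) this]
    define A B where "A = frechet_derivative X (at z)" and "B = frechet_derivative Y (at z)"
    interpret A: bounded_linear A unfolding A_def by (rule has_derivative_bounded_linear[OF dX])
    interpret B: bounded_linear B unfolding B_def by (rule has_derivative_bounded_linear[OF dY])
    have "expands (\<lambda>t. z) z 0 0" by (simp add: expands_def)
    moreover have "eventually (\<lambda>t. z \<in> F) (at_right (0 :: real))" using z(1) by simp
    ultimately obtain p1 where "expands p1 z (0 + X z) (0 + A 0 + A (X z) /\<^sub>R 2)"
      and p1: "eventually (\<lambda>t. p1 t \<in> F) (at_right 0)"
      using expands_step[OF \<open>open S\<close> F X z(1) dX] unfolding A_def by blast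
    then have "expands p1 z (X z) (A (X z) /\<^sub>R 2)" by (simp add: A.zero)
    from expands_step[OF \<open>open S\<close> F Y z(1) dY this p1]
    obtain p2 where p2: "expands p2 z (X z + Y z) (A (X z) /\<^sub>R 2 + B (X z) + B (Y z) /\<^sub>R 2)"
      "eventually (\<lambda>t. p2 t \<in> F) (at_right 0)"
      unfolding B_def by blast
    have half: "v = v /\<^sub>R 2 + v /\<^sub>R 2" for v :: 'a
      by (simp flip: scaleR_left_distrib)
    from expands_step[OF \<open>open S\<close> F tangent_to_minus[OF X(1)] neg[OF X(2)] z(1)
        has_derivative_minus[OF dX] p2]
    obtain p3 where p3: "expands p3 z (X z + Y z + - X z)
        (A (X z) /\<^sub>R 2 + B (X z) + B (Y z) /\<^sub>R 2 + - A (X z + Y z) + - A (- X z) /\<^sub>R 2)"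
      "eventually (\<lambda>t. p3 t \<in> F) (at_right 0)"
      unfolding A_def by blast
    have e3: "X z + Y z + - X z = Y z"
      "A (X z) /\<^sub>R 2 + B (X z) + B (Y z) /\<^sub>R 2 + - A (X z + Y z) + - A (- X z) /\<^sub>R 2
        = B (X z) + B (Y z) /\<^sub>R 2 - A (Y z)"
      using half[of "A (X z)"] by (simp_all add: A.add A.neg algebra_simps)
    from expands_step[OF \<open>open S\<close> F tangent_to_minus[OF Y(1)] neg[OF Y(2)] z(1)
        has_derivative_minus[OF dY] p3[unfolded e3]]
    obtain p where "expands p z (Y z + - Y z)
        (B (X z) + B (Y z) /\<^sub>R 2 - A (Y z) + - B (Y z) + - B (- Y z) /\<^sub>R 2)"
      and pF: "eventually (\<lambda>t. p t \<in> F) (at_right 0)"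
      unfolding B_def by blast
    moreover have "B (X z) + B (Y z) /\<^sub>R 2 - A (Y z) + - B (Y z) + - B (- Y z) /\<^sub>R 2 = B (X z) - A (Y z)"
      using half[of "B (Y z)"] by (simp add: B.neg algebra_simps)
    ultimately have p: "expands p z 0 (B (X z) - A (Y z))" by (simp only: add.right_inverse)
    define G where "G t = (p t - z) /\<^sub>R t\<^sup>2" for t
    have G: "(G \<longlongrightarrow> lie_bracket X Y z) (at_right 0)"
      using p by (simp add: expands_def G_def [abs_def] lie_bracket_def A_def B_def)
    \<comment> \<open>With \<open>p t = z + t\<^sup>2 G t\<close>, comparing the squared distances
      of \<open>z\<close> and \<open>p t\<close> from \<open>y\<close> and cancelling
      \<open>t\<^sup>2\<close> shows that this expression is at most 0; its second term vanishes in
      the limit.\<close>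
    have "((\<lambda>t. 2 * ((y - z) \<bullet> G t) - t\<^sup>2 * (norm (G t))\<^sup>2)
        \<longlongrightarrow> 2 * ((y - z) \<bullet> lie_bracket X Y z) - 0\<^sup>2 * (norm (lie_bracket X Y z))\<^sup>2) (at_right 0)"
      by (intro tendsto_intros G)
    moreover have "eventually (\<lambda>t. 2 * ((y - z) \<bullet> G t) - t\<^sup>2 * (norm (G t))\<^sup>2 \<le> 0) (at_right 0)"
      using pF eventually_at_right_less[of "0 :: real"]
    proof eventually_elim
      case (elim t)
      have pt: "p t = z + t\<^sup>2 *\<^sub>R G t" using elim by (simp add: G_def)
      have "dist y z \<le> dist y (p t)" using z(2) elim by (auto simp: disjoint_iff not_less)
      then have "(norm (y - z))\<^sup>2 \<le> (norm (y - z - t\<^sup>2 *\<^sub>R G t))\<^sup>2"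
        by (intro power_mono) (simp_all add: dist_norm pt diff_diff_eq)
      then have "t\<^sup>2 * (2 * ((y - z) \<bullet> G t)) \<le> t\<^sup>2 * (t\<^sup>2 * (norm (G t))\<^sup>2)"
        by (simp add: power2_norm_eq_inner inner_diff inner_commute algebra_simps)
      then have "2 * ((y - z) \<bullet> G t) \<le> t\<^sup>2 * (norm (G t))\<^sup>2"
        by (rule mult_left_le_imp_le) (use elim in simp)
      then show ?case by simp
    qed
    ultimately have "2 * ((y - z) \<bullet> lie_bracket X Y z) - 0\<^sup>2 * (norm (lie_bracket X Y z))\<^sup>2 \<le> 0"
      by (rule tendsto_upperbound) simp
    then show ?thesis by simp
  qed
  show ?thesis
    unfolding tangent_to_def
  proof (intro ballI allI impI)
    fix z y assume "z \<in> F" "ball y (dist y z) \<inter> F = {}"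
    from le[OF X Y this] le[OF Y X this] show "(y - z) \<bullet> lie_bracket X Y z = 0"
      by (simp add: lie_bracket_def inner_diff_right)
  qed
qed

text \<open>Apart from the bracket, the closure rules act pointwise on \<open>F\<close>. In the
  bracket case the smoothness that the commutator argument asks for is inherited from the
  generators.\<close>

lemma tangent_to_lie_module:
  fixes G :: "('a::euclidean_space \<Rightarrow> 'a) set"
  assumes "open S" and F: "closedin (top_of_set S) F"
    and G: "\<And>X. X \<in> G \<Longrightarrow> smooth_on S X" "\<And>X. X \<in> G \<Longrightarrow> tangent_to F X"
    and "Z \<in> lie_module S G"
  shows "tangent_to F Z"
  using assms(5)
proof induction
  case (bracket X Y)
  then show ?case
    by (intro tangent_to_lie_bracket[OF \<open>open S\<close> F] smooth_on_lie_module[OF \<open>open S\<close> G(1)])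
next
  case (cong X X')
  then have "X' z = X z" if "z \<in> F" for z
    using closedin_imp_subset[OF F] that by auto
  then show ?case using cong by (simp add: tangent_to_def)
qed (use G(2) in \<open>simp_all add: tangent_to_def inner_add_right\<close>)

text \<open>The times spent in \<open>F\<close> are relatively closed in \<open>I\<close> by
  continuity and relatively open by \<open>near_invariance\<close> with error 0; \<open>I\<close> is
  connected.\<close>

lemma integral_curve_stays:
  fixes Z :: "'a::euclidean_space \<Rightarrow> 'a"
  assumes "open S" and F: "closedin (top_of_set S) F"
    and Z: "tangent_to F Z" "smooth_on S Z" and curve: "integral_curve S Z I \<gamma>"
    and t0: "t0 \<in> I" "\<gamma> t0 \<in> F"
  shows "\<gamma> ` I \<subseteq> F"
proof -
  have I: "is_interval I" and \<gamma>S: "\<gamma> ` I \<subseteq> S"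
    and der: "\<And>t. t \<in> I \<Longrightarrow> (\<gamma> has_vector_derivative Z (\<gamma> t)) (at t within I)"
    using curve by (auto simp: integral_curve_def)
  have cont: "continuous_on I \<gamma>" by (rule continuous_on_vector_derivative[OF der])
  have local: "\<exists>d>0. \<forall>t\<in>I. dist t t1 < d \<longrightarrow> \<gamma> t \<in> F" if t1: "t1 \<in> I" "\<gamma> t1 \<in> F" for t1
  proof -
    have "\<gamma> t1 \<in> S" using F t1 closedin_imp_subset by blast
    then obtain r where r: "r > 0" "cball (\<gamma> t1) r \<subseteq> S"
      using \<open>open S\<close> open_contains_cball by blast
    define \<rho> where "\<rho> = r / 2"
    have \<rho>: "\<rho> > 0" "cball (\<gamma> t1) (2 * \<rho>) \<subseteq> S" using r by (auto simp: \<rho>_def)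
    obtain K where K: "K-lipschitz_on (cball (\<gamma> t1) (2 * \<rho>)) Z"
      using smooth_on_lipschitz[OF Z(2) compact_cball convex_cball \<rho>(2)] .
    have "\<exists>d>0. \<forall>t\<in>I. dist t t1 < d \<longrightarrow> dist (\<gamma> t) (\<gamma> t1) < \<rho>"
      using cont t1(1) \<rho>(1) unfolding continuous_on_iff by simp
    then obtain d where d: "d > 0" "\<And>t. t \<in> I \<Longrightarrow> dist t t1 < d \<Longrightarrow> dist (\<gamma> t) (\<gamma> t1) < \<rho>"
      by auto
    \<comment> \<open>The sign \<open>\<sigma>\<close> treats both time directions: run backwards,
      the curve integrates \<open>- Z\<close>, which is tangent with the same Lipschitz
      constant.\<close>
    have step: "\<gamma> (t1 + \<sigma> * T) \<in> F"
      if \<sigma>: "\<sigma> = 1 \<or> \<sigma> = -1" and T: "T > 0" "t1 + \<sigma> * T \<in> I" "T < d" for \<sigma> T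
    proof -
      have inI: "t1 + \<sigma> * s \<in> I" if "s \<in> {0..T}" for s
        using mem_is_interval_1_I[OF I t1(1) T(2)] mem_is_interval_1_I[OF I T(2) t1(1)] \<sigma> that
        by auto
      let ?F = "F \<inter> cball (\<gamma> t1) (2 * \<rho>)"
      have "infdist (\<gamma> (t1 + \<sigma> * T)) ?F \<le> exp (K * T + 1) * 0 * T"
      proof (rule near_invariance[where \<gamma> = "\<lambda>s. \<gamma> (t1 + \<sigma> * s)"
            and \<gamma>' = "\<lambda>s. \<sigma> *\<^sub>R Z (\<gamma> (t1 + \<sigma> * s))", OF compact_Int_cball[OF F \<rho>(2)] t1(2) \<rho>(1)])
        show "tangent_to F (\<lambda>x. \<sigma> *\<^sub>R Z x)" using Z(1) by (simp add: tangent_to_def)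
        show "K-lipschitz_on (cball (\<gamma> t1) (2 * \<rho>)) (\<lambda>x. \<sigma> *\<^sub>R Z x)"
          using lipschitz_on_cmult[OF K, of \<sigma>] \<sigma> by auto
        show "dist (\<gamma> t1) (\<gamma> (t1 + \<sigma> * s)) < \<rho>" if "s \<in> {0..T}" for s
          using d(2)[OF inI[OF that]] that T(3) \<sigma> by (auto simp: dist_commute dist_real_def)
        show "((\<lambda>s. \<gamma> (t1 + \<sigma> * s)) has_vector_derivative \<sigma> *\<^sub>R Z (\<gamma> (t1 + \<sigma> * s))) (at s within {0..T})"
          if "s \<in> {0..T}" for s
        proof -
          have "((\<lambda>s. t1 + \<sigma> * s) has_vector_derivative \<sigma>) (at s within {0..T})"
            by (auto intro!: derivative_eq_intros simp flip: has_real_derivative_iff_has_vector_derivative)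
          moreover have "(\<gamma> has_vector_derivative Z (\<gamma> (t1 + \<sigma> * s)))
              (at (t1 + \<sigma> * s) within (\<lambda>s. t1 + \<sigma> * s) ` {0..T})"
            using inI by (intro has_vector_derivative_within_subset[OF der[OF inI[OF that]]]) auto
          ultimately show ?thesis
            using vector_diff_chain_within by (fastforce simp: o_def)
        qed
      qed (use T t1 in auto)
      then have "infdist (\<gamma> (t1 + \<sigma> * T)) ?F = 0" using infdist_nonneg[of _ ?F] by (simp add: antisym)
      moreover have "closed ?F" "?F \<noteq> {}"
        using compact_Int_cball[OF F \<rho>(2)] compact_imp_closed t1(2) \<rho>(1) by auto
      ultimately show ?thesis using in_closed_iff_infdist_zero by blast
    qed
    show ?thesis
    proof (intro exI[of _ d] conjI ballI impI)
      fix t assume t: "t \<in> I" "dist t t1 < d"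
      consider "t = t1" | "t > t1" | "t < t1" by linarith
      then show "\<gamma> t \<in> F"
        using step[of 1 "t - t1"] step[of "-1" "t1 - t"] t t1 by cases (auto simp: dist_real_def)
    qed fact
  qed
  define A where "A = I \<inter> \<gamma> -` F"
  have "closedin (top_of_set I) A"
    unfolding A_def using \<gamma>S by (intro continuous_closedin_preimage_gen[OF cont _ F]) auto
  moreover have "openin (top_of_set I) A"
    unfolding openin_euclidean_subtopology_iff using local by (auto simp: A_def)
  moreover have "connected I" using I by (rule is_interval_connected)
  ultimately have "A = {} \<or> A = I" unfolding connected_clopen by blast
  then show ?thesis using t0 by (auto simp: A_def)
qed

section \<open>The Hopf barrier\<close>

text \<open>\<open>f'\<close> is known to be differentiable at 0 only. A positive \<open>H\<close>
  would make \<open>f'\<close> positive just to the right of its zero at 0, and by the mean value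
  theorem \<open>f\<close> would exceed its maximum.\<close>

lemma second_derivative_nonpos_at_max:
  fixes f f' :: "real \<Rightarrow> real"
  assumes "d > 0" and max: "\<And>t. \<bar>t\<bar> < d \<Longrightarrow> f t \<le> f 0"
    and f: "\<And>t. \<bar>t\<bar> < d \<Longrightarrow> (f has_real_derivative f' t) (at t)"
    and f': "(f' has_real_derivative H) (at 0)"
  shows "H \<le> 0"
proof (rule ccontr)
  assume "\<not> H \<le> 0"
  then obtain e where e: "e > 0" "\<And>h. h > 0 \<Longrightarrow> h < e \<Longrightarrow> f' 0 < f' h"
    using DERIV_pos_inc_right[OF f'] by auto
  have "f' 0 = 0"
    using DERIV_local_max[OF f \<open>d > 0\<close>] max \<open>d > 0\<close> by auto
  define h where "h = min d e / 2"
  have h: "0 < h" "h < d" "h < e" using \<open>d > 0\<close> e(1) by (auto simp: h_def min_def)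
  obtain c where "0 < c" "c < h" "f h - f 0 = (h - 0) * f' c"
    using MVT2[OF h(1), of f f'] f h by auto
  moreover have "f' c > 0" using e(2)[of c] \<open>f' 0 = 0\<close> h calculation by simp
  ultimately have "f h - f 0 > 0" using h by simp
  then show False using max[of h] h by simp
qed

text \<open>\<open>g (X x)\<close> is \<open>X (X v)\<close> at \<open>x\<close>. Since the gradient
  of \<open>v\<close> vanishes there, the terms that differentiate \<open>X\<close> drop out,
  leaving the second derivative of \<open>v\<close> along the line with frozen direction
  \<open>X x\<close>.\<close>

lemma second_vf_derivative_nonpos_at_max:
  fixes v :: "'a::euclidean_space \<Rightarrow> real"
  assumes "open B" "x \<in> B" and max: "\<And>y. y \<in> B \<Longrightarrow> v y \<le> v x"
    and v: "\<And>y. y \<in> B \<Longrightarrow> (v has_derivative v' y) (at y)"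
    and v': "\<And>b. (\<lambda>y. v' y b) differentiable at x"
    and X: "(X has_derivative D) (at x)"
    and g: "((\<lambda>y. v' y (X y)) has_derivative g) (at x)"
  shows "g (X x) \<le> 0"
proof -
  have vx: "v' x = (\<lambda>h. 0)"
    using differential_zero_maxmin[OF \<open>x \<in> B\<close> \<open>open B\<close> v[OF \<open>x \<in> B\<close>]] max by blast
  from v' obtain H where H: "\<And>b. ((\<lambda>y. v' y b) has_derivative H b) (at x)"
    unfolding differentiable_def by metis
  have lin: "v' y h = (\<Sum>b\<in>Basis. (h \<bullet> b) *\<^sub>R v' y b)" if "y \<in> B" for y h
    by (rule linear_sum_Basis[OF has_derivative_linear[OF v[OF that]]])
  define \<xi> where "\<xi> = X x"
  have "((\<lambda>y. \<Sum>b\<in>Basis. (X y \<bullet> b) *\<^sub>R v' y b) has_derivative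
      (\<lambda>h. \<Sum>b\<in>Basis. (X x \<bullet> b) *\<^sub>R H b h + (D h \<bullet> b) *\<^sub>R v' x b)) (at x)"
    by (intro has_derivative_sum has_derivative_scaleR has_derivative_inner_left X H)
  then have "((\<lambda>y. v' y (X y)) has_derivative (\<lambda>h. \<Sum>b\<in>Basis. (\<xi> \<bullet> b) *\<^sub>R H b h)) (at x)"
    unfolding vx \<xi>_def scaleR_zero_right add_0_right
    by (rule has_derivative_transform_within_open[OF _ \<open>open B\<close> \<open>x \<in> B\<close>]) (rule lin[symmetric])
  then have gH: "g = (\<lambda>h. \<Sum>b\<in>Basis. (\<xi> \<bullet> b) *\<^sub>R H b h)"
    using g by (rule has_derivative_unique[rotated])
  have "((\<lambda>y. \<Sum>b\<in>Basis. (\<xi> \<bullet> b) *\<^sub>R v' y b) has_derivative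
      (\<lambda>h. \<Sum>b\<in>Basis. (\<xi> \<bullet> b) *\<^sub>R H b h)) (at x)"
    by (intro has_derivative_sum has_derivative_scaleR_right H)
  then have dir: "((\<lambda>y. v' y \<xi>) has_derivative g) (at x)"
    unfolding gH
    by (rule has_derivative_transform_within_open[OF _ \<open>open B\<close> \<open>x \<in> B\<close>]) (rule lin[symmetric])
  obtain r where r: "r > 0" "ball x r \<subseteq> B"
    using \<open>open B\<close> \<open>x \<in> B\<close> open_contains_ball by blast
  define d where "d = r / (norm \<xi> + 1)"
  have n: "norm \<xi> + 1 > 0" by (simp add: add_nonneg_pos)
  have "d > 0" using r n by (simp add: d_def)
  have inB: "x + t *\<^sub>R \<xi> \<in> B" if "\<bar>t\<bar> < d" for t
  proof -
    have "\<bar>t\<bar> * norm \<xi> \<le> \<bar>t\<bar> * (norm \<xi> + 1)" by (intro mult_left_mono) auto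
    also have "\<dots> < r" using that n by (simp add: d_def pos_less_divide_eq)
    finally show ?thesis using r(2) by (auto simp: dist_norm)
  qed
  have line: "((\<lambda>t. x + t *\<^sub>R \<xi>) has_derivative (\<lambda>h. h *\<^sub>R \<xi>)) (at t)" for t
    by (auto intro!: derivative_eq_intros)
  show ?thesis
  proof (rule second_derivative_nonpos_at_max[OF \<open>d > 0\<close>])
    show "v (x + t *\<^sub>R \<xi>) \<le> v (x + 0 *\<^sub>R \<xi>)" if "\<bar>t\<bar> < d" for t
      using max[OF inB[OF that]] by simp
    show "((\<lambda>t. v (x + t *\<^sub>R \<xi>)) has_real_derivative v' (x + t *\<^sub>R \<xi>) \<xi>) (at t)" if "\<bar>t\<bar> < d" for t
    proof -
      have "((\<lambda>t. v (x + t *\<^sub>R \<xi>)) has_derivative (\<lambda>h. v' (x + t *\<^sub>R \<xi>) (h *\<^sub>R \<xi>))) (at t)"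
        by (rule has_derivative_compose[OF line v[OF inB[OF that]]])
      moreover have "v' (x + t *\<^sub>R \<xi>) (h *\<^sub>R \<xi>) = v' (x + t *\<^sub>R \<xi>) \<xi> * h" for h
        using linear_scale[OF has_derivative_linear[OF v[OF inB[OF that]]]] by (simp add: mult.commute)
      ultimately show ?thesis by (simp add: has_field_derivative_def)
    qed
    have "((\<lambda>t. v' (x + t *\<^sub>R \<xi>) \<xi>) has_derivative (\<lambda>h. g (h *\<^sub>R \<xi>))) (at 0)"
      using has_derivative_compose[OF line[of 0], of "\<lambda>y. v' y \<xi>" g] dir by simp
    moreover have "g (h *\<^sub>R \<xi>) = g (X x) * h" for h
      using linear_scale[OF has_derivative_linear[OF g]] by (simp add: \<xi>_def mult.commute)
    ultimately show "((\<lambda>t. v' (x + t *\<^sub>R \<xi>) \<xi>) has_real_derivative g (X x)) (at 0)"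
      by (simp add: has_field_derivative_def)
  qed
qed

text \<open>Applying \<open>X j\<close> twice to \<open>exp (- \<alpha> |x - c|^2)\<close> gives the
  leading factor \<open>4 \<alpha>^2 ((x - c) \<bullet> X j x)^2\<close>. These squares are
  nonnegative for every \<open>j\<close>, so one field that is not orthogonal to the normal makes
  their sum outgrow all terms of order \<open>\<alpha>\<close>, even though the operator may be
  degenerate.\<close>

lemma Hopf_tangent:
  fixes u :: "'a::euclidean_space \<Rightarrow> real"
  assumes "open S" "finite A" and u: "smooth_on S u" and X: "\<And>k. k \<in> A \<Longrightarrow> smooth_on S (X k)"
    and "M \<ge> 0" and le_M: "\<And>x. x \<in> S \<Longrightarrow> u x \<le> M"
    and sub: "\<And>x r. cball x r \<subseteq> S \<Longrightarrow> \<exists>C\<ge>0. \<forall>z\<in>cball x r.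
      0 \<le> (\<Sum>k\<in>A. vf_apply (X k) (vf_apply (X k) u) z)
        + C * (onorm (frechet_derivative u (at z)) + max 0 (- u z))"
    and "k \<in> A"
  shows "tangent_to {x \<in> S. u x = M} (X k)"
  unfolding tangent_to_def
proof (intro ballI allI impI, rule ccontr)
  fix z y
  assume z: "z \<in> {x \<in> S. u x = M}" and ball: "ball y (dist y z) \<inter> {x \<in> S. u x = M} = {}"
    and ne: "(y - z) \<bullet> X k z \<noteq> 0"
  \<comment> \<open>The given ball may touch the maximum set at several points; the closed ball of
    half the radius, tangent at \<open>z\<close>, meets it at \<open>z\<close> only.\<close>
  define c where "c = z + (y - z) /\<^sub>R 2"
  define R where "R = norm (z - c)"
  have yz: "y - z = 2 *\<^sub>R (c - z)" by (simp add: c_def)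
  have only: "f = z" if f: "f \<in> S" "u f = M" "norm (f - c) \<le> R" for f
  proof -
    define p n where "p = f - z" and "n = c - z"
    have "norm (p - n) \<le> norm n"
      using f(3) by (simp add: p_def n_def R_def norm_minus_commute)
    then have 1: "(norm (p - n))\<^sup>2 \<le> (norm n)\<^sup>2" by (intro power_mono) auto
    have "dist y z \<le> dist y f" using ball f by (auto simp: disjoint_iff not_less)
    moreover have "y - f = 2 *\<^sub>R n - p" unfolding n_def yz[symmetric] by (simp add: p_def)
    ultimately have "norm (2 *\<^sub>R n) \<le> norm (2 *\<^sub>R n - p)"
      unfolding dist_norm yz by (simp only: n_def)
    then have "(norm (2 *\<^sub>R n))\<^sup>2 \<le> (norm (2 *\<^sub>R n - p))\<^sup>2" by (intro power_mono) auto
    with 1 have "p \<bullet> p \<le> 2 * (p \<bullet> n)" "4 * (p \<bullet> n) \<le> p \<bullet> p"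
      by (simp_all add: power2_norm_eq_inner inner_diff inner_commute algebra_simps)
    then have "p \<bullet> p \<le> 0" by linarith
    then have "p \<bullet> p = 0" using inner_ge_zero[of p] by linarith
    then show "f = z" by (simp add: p_def)
  qed

  \<comment> \<open>Half of the value at \<open>z\<close>, so that by continuity it remains a strict
    lower bound on a small ball about \<open>z\<close>.\<close>
  define \<kappa> where "\<kappa> = ((z - c) \<bullet> X k z)\<^sup>2 / 2"
  have "(y - z) \<bullet> X k z = - 2 * ((z - c) \<bullet> X k z)"
    unfolding yz by (simp add: inner_diff_left)
  with ne have "\<kappa> > 0" by (simp add: \<kappa>_def)
  have "open (S \<inter> (\<lambda>x. ((x - c) \<bullet> X k x)\<^sup>2) -` {\<kappa><..})"
    using smooth_on_imp_continuous_on[OF X[OF \<open>k \<in> A\<close>]]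
    by (intro continuous_open_preimage continuous_intros \<open>open S\<close>) auto
  moreover have "z \<in> S \<inter> (\<lambda>x. ((x - c) \<bullet> X k x)\<^sup>2) -` {\<kappa><..}"
    using z \<open>\<kappa> > 0\<close> by (simp add: \<kappa>_def)
  ultimately obtain r where "r > 0" and r: "cball z r \<subseteq> S \<inter> (\<lambda>x. ((x - c) \<bullet> X k x)\<^sup>2) -` {\<kappa><..}"
    using open_contains_cball by blast
  then have rS: "cball z r \<subseteq> S" and r\<kappa>: "\<And>x. x \<in> cball z r \<Longrightarrow> ((x - c) \<bullet> X k x)\<^sup>2 > \<kappa>"
    by auto
  obtain C where "C \<ge> 0" and C: "\<And>x. x \<in> cball z r \<Longrightarrow>
      0 \<le> (\<Sum>k\<in>A. vf_apply (X k) (vf_apply (X k) u) x)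
        + C * (onorm (frechet_derivative u (at x)) + max 0 (- u x))"
    using sub[OF rS] by blast
  define DX where "DX j x = frechet_derivative (X j) (at x)" for j x
  have DX: "(X j has_derivative DX j x) (at x)" if "j \<in> A" "x \<in> S" for j x
    using smooth_on_has_derivative[OF X] that by (simp add: DX_def)
  \<comment> \<open>The sum of \<open>X j (X j q)\<close> for \<open>q x = |x - c|^2 / 2\<close>:
    the part of the second derivatives of the barrier that is only linear in
    \<open>\<alpha>\<close>.\<close>
  define Q where "Q x = (\<Sum>j\<in>A. X j x \<bullet> X j x + (x - c) \<bullet> DX j x (X j x))" for x
  have "continuous_on S Q"
    unfolding Q_def DX_def using X
    by (intro continuous_intros smooth_on_imp_continuous_on smooth_on_frechet_derivative[OF \<open>open S\<close>]) auto
  then have "bounded (Q ` cball z r)"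
    using rS by (intro compact_imp_bounded compact_continuous_image) (auto elim: continuous_on_subset)
  then obtain C1 where C1: "\<And>x. x \<in> cball z r \<Longrightarrow> \<bar>Q x\<bar> \<le> C1"
    unfolding bounded_iff real_norm_def by blast
  have "C1 \<ge> 0" using C1[of z] \<open>r > 0\<close> by simp
  define N where "N = r + R"
  have N: "norm (x - c) \<le> N" if "x \<in> cball z r" for x
    using that norm_triangle_ineq[of "x - z" "z - c"] by (simp add: N_def R_def dist_norm norm_minus_commute)
  have "N \<ge> 0" using N[of z] \<open>r > 0\<close> norm_ge_zero order_trans by (metis centre_in_cball less_imp_le)
  \<comment> \<open>Solves \<open>4 * \<kappa> * \<alpha> = 2 * C1 + 2 * C * N + C + 4 *
    \<kappa>\<close>. The added 1 gives strictness and \<open>\<alpha> \<ge> 1\<close>, by which the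
    constant term \<open>C\<close> is at most \<open>\<alpha> * C\<close>.\<close>
  define \<alpha> where "\<alpha> = (2 * C1 + 2 * C * N + C) / (4 * \<kappa>) + 1"
  have "\<alpha> \<ge> 1" using \<open>C1 \<ge> 0\<close> \<open>C \<ge> 0\<close> \<open>N \<ge> 0\<close> \<open>\<kappa> > 0\<close> by (simp add: \<alpha>_def)
  have \<alpha>: "2 * \<alpha> * C1 + C * (2 * \<alpha> * N + 1) < 4 * \<alpha>\<^sup>2 * \<kappa>"
  proof -
    have "4 * \<kappa> * \<alpha> = 2 * C1 + 2 * C * N + C + 4 * \<kappa>"
      using \<open>\<kappa> > 0\<close> by (simp add: \<alpha>_def field_simps)
    then have "2 * C1 + 2 * C * N + C < 4 * \<kappa> * \<alpha>" using \<open>\<kappa> > 0\<close> by simp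
    then have "\<alpha> * (2 * C1 + 2 * C * N + C) < \<alpha> * (4 * \<kappa> * \<alpha>)" using \<open>\<alpha> \<ge> 1\<close> by simp
    moreover have "C \<le> \<alpha> * C" using mult_right_mono[OF \<open>\<alpha> \<ge> 1\<close> \<open>C \<ge> 0\<close>] by simp
    ultimately show ?thesis by (simp add: algebra_simps power2_eq_square)
  qed

  define E where "E x = exp (- (\<alpha> * ((x - c) \<bullet> (x - c))))" for x
  \<comment> \<open>Zero on the sphere about \<open>c\<close> through \<open>z\<close>, positive
    inside it and negative outside.\<close>
  define w where "w x = E x - E z" for x
  define w' where "w' x h = - (2 * \<alpha> * (E x * ((x - c) \<bullet> h)))" for x h
  have dE: "(E has_derivative w' x) (at x)" for x
    unfolding E_def w'_def by (auto intro!: derivative_eq_intros simp: fun_eq_iff inner_commute algebra_simps)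
  have dw: "(w has_derivative w' x) (at x)" for x
    unfolding w_def by (auto intro!: derivative_eq_intros dE)
  have Epos: "E x > 0" for x by (simp add: E_def)
  have w_le_1: "w x \<le> 1" for x
  proof -
    have "E x \<le> 1" using \<open>\<alpha> \<ge> 1\<close> by (simp add: E_def)
    then show ?thesis using Epos[of z] by (simp add: w_def)
  qed
  have w_neg: "w x < 0" if "norm (x - c) > R" for x
  proof -
    have "R\<^sup>2 < (norm (x - c))\<^sup>2" using that by (intro power_strict_mono) (auto simp: R_def)
    then show ?thesis using \<open>\<alpha> \<ge> 1\<close> by (simp add: w_def E_def R_def power2_norm_eq_inner)
  qed
  have ddw: "((\<lambda>x. w' x (X j x)) has_derivative
      (\<lambda>h. w' x h * (- (2 * \<alpha>) * ((x - c) \<bullet> X j x)) - 2 * \<alpha> * E x * (h \<bullet> X j x + (x - c) \<bullet> DX j x h))) (at x)"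
    if "j \<in> A" "x \<in> S" for j x
    unfolding w'_def
    by (auto intro!: derivative_eq_intros dE[unfolded w'_def] DX[OF that] simp: fun_eq_iff algebra_simps)

  \<comment> \<open>Outside \<open>cball c R\<close> the barrier is negative and any
    \<open>\<epsilon>\<close> works. The rest of the sphere about \<open>z\<close> is compact and
    misses the maximum set, so \<open>u\<close> stays below \<open>M\<close> by a fixed gap there,
    and \<open>w \<le> 1\<close> fits a small multiple into it.\<close>
  obtain \<epsilon> where "\<epsilon> > 0" and \<epsilon>: "\<And>x. dist z x = r \<Longrightarrow> u x + \<epsilon> * w x < M"
  proof -
    define P where "P = sphere z r \<inter> cball c R"
    have "compact P" by (simp add: P_def compact_Int_closed)
    obtain \<epsilon> where "\<epsilon> > 0" and \<epsilon>: "\<And>x. x \<in> P \<Longrightarrow> u x + \<epsilon> < M"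
    proof (cases "P = {}")
      case False
      have PS: "P \<subseteq> S" using rS sphere_cball by (fastforce simp: P_def)
      obtain x where x: "x \<in> P" "\<And>y. y \<in> P \<Longrightarrow> u y \<le> u x"
        using continuous_attains_sup[OF \<open>compact P\<close> False
            continuous_on_subset[OF smooth_on_imp_continuous_on[OF u] PS]] by blast
      have xS: "x \<in> S" and "x \<noteq> z" "norm (x - c) \<le> R"
        using x(1) PS \<open>r > 0\<close> by (auto simp: P_def dist_norm norm_minus_commute)
      then have "u x < M" using only[of x] le_M[of x] by fastforce
      then show ?thesis using x(2) by (intro that[of "(M - u x) / 2"]) (force simp: field_simps)+
    qed (use that[of 1] in auto)
    show ?thesis
    proof (rule that[OF \<open>\<epsilon> > 0\<close>])
      fix x assume x: "dist z x = r"
      show "u x + \<epsilon> * w x < M"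
      proof (cases "norm (x - c) > R")
        case True
        then have "\<epsilon> * w x < 0" using w_neg \<open>\<epsilon> > 0\<close> by (simp add: mult_pos_neg)
        moreover have "u x \<le> M" using x rS by (intro le_M) auto
        ultimately show ?thesis by simp
      next
        case False
        then have "u x + \<epsilon> < M" using x by (intro \<epsilon>) (simp add: P_def dist_norm norm_minus_commute)
        moreover have "\<epsilon> * w x \<le> \<epsilon>" using w_le_1[of x] \<open>\<epsilon> > 0\<close> by simp
        ultimately show ?thesis by simp
      qed
    qed
  qed

  define v where "v x = u x + \<epsilon> * w x" for x
  have "continuous_on (cball z r) v"
    unfolding v_def w_def E_def
    by (intro continuous_intros continuous_on_subset[OF smooth_on_imp_continuous_on[OF u] rS])
  moreover have "cball z r \<noteq> {}" using \<open>r > 0\<close> by simp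
  ultimately obtain x where xr: "x \<in> cball z r" and max: "\<And>y. y \<in> cball z r \<Longrightarrow> v y \<le> v x"
    using continuous_attains_sup[OF compact_cball] by blast
  \<comment> \<open>As \<open>v z = M\<close> while \<open>v < M\<close> on the boundary sphere, the
    maximum is attained in the open ball.\<close>
  have "v z \<le> v x" using \<open>r > 0\<close> by (intro max) simp
  then have vx: "M \<le> u x + \<epsilon> * w x" using z by (simp add: v_def w_def)
  then have xB: "x \<in> ball z r" using \<epsilon>[of x] xr by (cases "dist z x = r") auto
  have xS: "x \<in> S" using xr rS by auto
  define Du where "Du y = frechet_derivative u (at y)" for y
  have Du: "(u has_derivative Du y) (at y)" if "y \<in> S" for y
    unfolding Du_def by (rule smooth_on_has_derivative[OF u that])
  define v' where "v' y h = Du y h + \<epsilon> * w' y h" for y h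
  have dv: "(v has_derivative v' y) (at y)" if "y \<in> S" for y
    unfolding v_def v'_def by (auto intro!: derivative_eq_intros Du[OF that] dw)
  \<comment> \<open>The gradient of \<open>u\<close> is minus \<open>\<epsilon>\<close> times that
    of \<open>w\<close>, so the gradient term carries the same factor
    \<open>\<epsilon> * E x\<close> as the second-order terms; this is why \<open>\<alpha>\<close>
    could be fixed before \<open>\<epsilon>\<close>.\<close>
  have grad: "Du x h = \<epsilon> * (2 * \<alpha> * E x) * ((x - c) \<bullet> h)" for h
  proof -
    have "v' x = (\<lambda>h. 0)"
      using differential_zero_maxmin[OF xB open_ball dv[OF xS]] max by auto
    then show ?thesis by (simp add: v'_def w'_def fun_eq_iff eq_neg_iff_add_eq_0 algebra_simps)
  qed
  have second: "vf_apply (X j) (vf_apply (X j) u) x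
      \<le> - (\<epsilon> * E x * (4 * \<alpha>\<^sup>2 * ((x - c) \<bullet> X j x)\<^sup>2
          - 2 * \<alpha> * (X j x \<bullet> X j x + (x - c) \<bullet> DX j x (X j x))))"
    if "j \<in> A" for j
  proof -
    define U where "U = frechet_derivative (vf_apply (X j) u) (at x)"
    have "(vf_apply (X j) u has_derivative U) (at x)"
      unfolding U_def by (rule smooth_on_has_derivative[OF smooth_on_vf_apply[OF \<open>open S\<close> X[OF that] u] xS])
    then have U: "((\<lambda>y. Du y (X j y)) has_derivative U) (at x)"
      by (simp add: vf_apply_def [abs_def] Du_def)
    have "((\<lambda>y. v' y (X j y)) has_derivative (\<lambda>h. U h + \<epsilon> *
        (w' x h * (- (2 * \<alpha>) * ((x - c) \<bullet> X j x)) - 2 * \<alpha> * E x * (h \<bullet> X j x + (x - c) \<bullet> DX j x h)))) (at x)"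
      unfolding v'_def by (intro has_derivative_add U has_derivative_mult_right ddw that xS)
    note le = second_vf_derivative_nonpos_at_max[where v = v and v' = v' and X = "X j", OF open_ball xB _ _ _ DX[OF that xS] this]
    have "U (X j x) + \<epsilon> * (w' x (X j x) * (- (2 * \<alpha>) * ((x - c) \<bullet> X j x))
        - 2 * \<alpha> * E x * (X j x \<bullet> X j x + (x - c) \<bullet> DX j x (X j x))) \<le> 0"
    proof (rule le)
      show "v y \<le> v x" if "y \<in> ball z r" for y using max that by simp
      show "(v has_derivative v' y) (at y)" if "y \<in> ball z r" for y
      proof (rule dv)
        show "y \<in> S" using subsetD[OF rS, of y] that by simp
      qed
      show "(\<lambda>y. v' y b) differentiable at x" for b
        unfolding v'_def w'_def Du_def
        by (intro differentiable_add differentiable_mult differentiable_minus differentiable_inner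
            differentiable_diff differentiable_const differentiable_ident
            differentiableI[OF dE]
            smooth_on_imp_differentiable[OF smooth_on_frechet_derivative_const[OF u] xS])
    qed
    then show ?thesis
      by (simp add: vf_apply_def[of "X j" "vf_apply (X j) u"] U_def w'_def power2_eq_square algebra_simps)
  qed
  have "(\<Sum>j\<in>A. vf_apply (X j) (vf_apply (X j) u) x)
      \<le> (\<Sum>j\<in>A. - (\<epsilon> * E x * (4 * \<alpha>\<^sup>2 * ((x - c) \<bullet> X j x)\<^sup>2
          - 2 * \<alpha> * (X j x \<bullet> X j x + (x - c) \<bullet> DX j x (X j x)))))"
    by (rule sum_mono[OF second])
  also have "\<dots> = - (\<epsilon> * E x * (4 * \<alpha>\<^sup>2 * (\<Sum>j\<in>A. ((x - c) \<bullet> X j x)\<^sup>2) - 2 * \<alpha> * Q x))"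
    by (simp only: Q_def sum_negf sum_subtractf flip: sum_distrib_left)
  also have "\<dots> \<le> - (\<epsilon> * E x * (4 * \<alpha>\<^sup>2 * \<kappa> - 2 * \<alpha> * C1))"
  proof -
    have "\<kappa> \<le> (\<Sum>j\<in>A. ((x - c) \<bullet> X j x)\<^sup>2)"
      using r\<kappa>[OF xr] member_le_sum[OF \<open>k \<in> A\<close>, of "\<lambda>j. ((x - c) \<bullet> X j x)\<^sup>2"] \<open>finite A\<close> by force
    then have "4 * \<alpha>\<^sup>2 * \<kappa> \<le> 4 * \<alpha>\<^sup>2 * (\<Sum>j\<in>A. ((x - c) \<bullet> X j x)\<^sup>2)" by (intro mult_left_mono) auto
    moreover have "2 * \<alpha> * Q x \<le> 2 * \<alpha> * C1"
      using C1[OF xr] \<open>\<alpha> \<ge> 1\<close> by (intro mult_left_mono) auto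
    ultimately show ?thesis
      using \<open>\<epsilon> > 0\<close> Epos[of x] by (simp add: mult_left_mono)
  qed
  finally have sq: "(\<Sum>j\<in>A. vf_apply (X j) (vf_apply (X j) u) x)
      \<le> - (\<epsilon> * E x * (4 * \<alpha>\<^sup>2 * \<kappa> - 2 * \<alpha> * C1))" .
  have "onorm (Du x) \<le> \<epsilon> * E x * (2 * \<alpha> * N)"
  proof (rule onorm_bound)
    show "0 \<le> \<epsilon> * E x * (2 * \<alpha> * N)"
      using \<open>\<epsilon> > 0\<close> Epos[of x] \<open>\<alpha> \<ge> 1\<close> \<open>N \<ge> 0\<close> by simp
    fix h
    have "\<bar>(x - c) \<bullet> h\<bar> \<le> N * norm h"
      by (rule order_trans[OF Cauchy_Schwarz_ineq2 mult_right_mono[OF N[OF xr] norm_ge_zero]])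
    then have "\<epsilon> * (2 * \<alpha> * E x) * \<bar>(x - c) \<bullet> h\<bar> \<le> \<epsilon> * (2 * \<alpha> * E x) * (N * norm h)"
      using \<open>\<epsilon> > 0\<close> Epos[of x] \<open>\<alpha> \<ge> 1\<close> by (intro mult_left_mono) auto
    then show "norm (Du x h) \<le> \<epsilon> * E x * (2 * \<alpha> * N) * norm h"
      using \<open>\<epsilon> > 0\<close> Epos[of x] \<open>\<alpha> \<ge> 1\<close> by (simp add: grad abs_mult mult_ac)
  qed
  \<comment> \<open>Here \<open>M \<ge> 0\<close> enters:
    \<open>u x \<ge> M - \<epsilon> * w x\<close>, and \<open>w x \<le> E x\<close>.\<close>
  moreover have "max 0 (- u x) \<le> \<epsilon> * E x"
  proof -
    have "\<epsilon> * w x \<le> \<epsilon> * E x" using Epos[of z] \<open>\<epsilon> > 0\<close> by (simp add: w_def)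
    moreover have "0 \<le> \<epsilon> * E x" using Epos[of x] \<open>\<epsilon> > 0\<close> by simp
    ultimately show ?thesis using vx \<open>M \<ge> 0\<close> by simp
  qed
  ultimately have "C * (onorm (Du x) + max 0 (- u x)) \<le> C * (\<epsilon> * E x * (2 * \<alpha> * N) + \<epsilon> * E x)"
    using \<open>C \<ge> 0\<close> by (intro mult_left_mono add_mono)
  with sq C[OF xr] have "0 \<le> - (\<epsilon> * E x * (4 * \<alpha>\<^sup>2 * \<kappa> - 2 * \<alpha> * C1)) + C * (\<epsilon> * E x * (2 * \<alpha> * N) + \<epsilon> * E x)"
    unfolding Du_def by linarith
  also have "\<dots> = \<epsilon> * E x * (2 * \<alpha> * C1 + C * (2 * \<alpha> * N + 1) - 4 * \<alpha>\<^sup>2 * \<kappa>)"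
    by (simp add: algebra_simps)
  also have "\<dots> < 0"
    using \<alpha> \<open>\<epsilon> > 0\<close> Epos[of x] by (intro mult_pos_neg) auto
  finally show False by simp
qed

section \<open>The difference inequality\<close>

lemma smooth_on_compact_bound:
  fixes f :: "'a::euclidean_space \<Rightarrow> 'b::real_normed_vector"
  assumes "smooth_on S f" "compact K" "K \<subseteq> S"
  obtains B where "B \<ge> 0" "\<And>x. x \<in> K \<Longrightarrow> norm (f x) \<le> B"
proof -
  have "bounded (f ` K)"
    by (intro compact_imp_bounded compact_continuous_image \<open>compact K\<close>
        continuous_on_subset[OF smooth_on_imp_continuous_on[OF assms(1)] \<open>K \<subseteq> S\<close>])
  then obtain B where "\<forall>x\<in>K. norm (f x) \<le> B" unfolding bounded_iff by blast
  then show ?thesis by (intro that[of "max B 0"]) auto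
qed

lemma frame_gradient_compact_bound:
  fixes u :: "real^'n::finite \<Rightarrow> real"
  assumes "open S" "\<And>i. smooth_on S (e i)" "smooth_on S u" "compact K" "K \<subseteq> S"
  obtains P where "P \<ge> 0" "\<And>x. x \<in> K \<Longrightarrow> norm (frame_gradient e u x) \<le> P"
proof -
  have "\<exists>B\<ge>0. \<forall>x\<in>K. norm (vf_apply (e i) u x) \<le> B" for i
    by (rule smooth_on_compact_bound[OF smooth_on_vf_apply[OF assms(1-3)] assms(4,5)]) blast
  then obtain B where B: "\<And>i. B i \<ge> 0" "\<And>i x. x \<in> K \<Longrightarrow> norm (vf_apply (e i) u x) \<le> B i" by metis
  show ?thesis
  proof (rule that[of "\<Sum>i\<in>UNIV. B i"])
    fix x assume "x \<in> K"
    then show "norm (frame_gradient e u x) \<le> (\<Sum>i\<in>UNIV. B i)"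
      using B(2) by (intro order_trans[OF norm_le_l1_cart] sum_mono) (simp add: frame_gradient_def)
  qed (simp add: B(1) sum_nonneg)
qed

text \<open>With \<open>p\<close> and \<open>q\<close> the frame gradients of \<open>\<phi>\<close>
  and \<open>\<psi>\<close>, the difference of the operators splits into \<open>a\<close> at
  \<open>p\<close> applied to \<open>u\<close>, the change of \<open>a\<close> from \<open>p\<close>
  to \<open>q\<close> applied to \<open>\<psi>\<close>, the change of \<open>b\<close> from
  \<open>p\<close> to \<open>q\<close> at \<open>\<phi>\<close>, and the change of \<open>b\<close>
  from \<open>\<phi>\<close> to \<open>\<psi>\<close> at \<open>q\<close>. All but the first are
  bounded by the gradient of \<open>u\<close> and by \<open>u\<^sup>-\<close>.\<close>

lemma quasilinear_difference_inequality:
  fixes \<Omega> :: "(real^'n::finite) set"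
  assumes "open \<Omega>"
    and e_smooth: "\<And>i. smooth_on \<Omega> (e i)"
    and a_smooth: "\<And>i j. smooth_on (\<Omega> \<times> UNIV) (\<lambda>(x, p). a i j x p)"
    and b_smooth: "smooth_on (\<Omega> \<times> UNIV \<times> UNIV) (\<lambda>(x, z, p). b x z p)"
    and \<phi>: "smooth_on \<Omega> \<phi>" and \<psi>: "smooth_on \<Omega> \<psi>"
    and Q_ge: "\<And>x. x \<in> \<Omega> \<Longrightarrow> quasilinear_op e a b \<phi> x \<ge> quasilinear_op e a b \<psi> x"
    and b_decreasing: "\<And>x z p. x \<in> \<Omega> \<Longrightarrow> deriv (\<lambda>s. b x s p) z \<le> 0"
    and Y: "smooth_on \<Omega> Y"
    and sum_of_squares: "\<And>u x. smooth_on \<Omega> u \<Longrightarrow> x \<in> \<Omega> \<Longrightarrow>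
          (\<Sum>i\<in>UNIV. \<Sum>j\<in>UNIV.
             a i j x (frame_gradient e \<phi> x) * vf_apply (e i) (vf_apply (e j) u) x)
          = (\<Sum>k\<in>A. vf_apply (X k) (vf_apply (X k) u) x) + vf_apply Y u x"
    and V: "cball x0 r \<subseteq> \<Omega>"
  shows "\<exists>C\<ge>0. \<forall>x\<in>cball x0 r.
      0 \<le> (\<Sum>k\<in>A. vf_apply (X k) (vf_apply (X k) (\<lambda>x. \<phi> x - \<psi> x)) x)
        + C * (onorm (frechet_derivative (\<lambda>x. \<phi> x - \<psi> x) (at x)) + max 0 (- (\<phi> x - \<psi> x)))"
proof -
  define u where "u = (\<lambda>x. \<phi> x - \<psi> x)"
  have u: "smooth_on \<Omega> u" unfolding u_def by (rule smooth_on_diff[OF \<open>open \<Omega>\<close> \<phi> \<psi>])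
  have cV: "compact (cball x0 r)" by simp
  obtain P1 where P1: "P1 \<ge> 0" "\<And>x. x \<in> cball x0 r \<Longrightarrow> norm (frame_gradient e \<phi> x) \<le> P1"
    by (rule frame_gradient_compact_bound[of \<Omega> e, OF \<open>open \<Omega>\<close> e_smooth \<phi> cV V]) (rule that)
  obtain P2 where P2: "P2 \<ge> 0" "\<And>x. x \<in> cball x0 r \<Longrightarrow> norm (frame_gradient e \<psi> x) \<le> P2"
    by (rule frame_gradient_compact_bound[of \<Omega> e, OF \<open>open \<Omega>\<close> e_smooth \<psi> cV V]) (rule that)
  \<comment> \<open>One ball for both frame gradients, so that \<open>p\<close> and \<open>q\<close>
    lie in a common compact convex box on which the coefficients are Lipschitz; \<open>W\<close>
    does the same for the values of \<open>\<phi>\<close> and \<open>\<psi>\<close>.\<close>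
  define P where "P = P1 + P2"
  have P\<phi>: "frame_gradient e \<phi> x \<in> cball 0 P" and P\<psi>: "frame_gradient e \<psi> x \<in> cball 0 P"
    if "x \<in> cball x0 r" for x
    using P1(1) P2(1) P1(2)[OF that] P2(2)[OF that] by (simp_all add: P_def)
  obtain Z1 where Z1: "Z1 \<ge> 0" "\<And>x. x \<in> cball x0 r \<Longrightarrow> norm (\<phi> x) \<le> Z1"
    by (rule smooth_on_compact_bound[OF \<phi> cV V]) (rule that)
  obtain Z2 where Z2: "Z2 \<ge> 0" "\<And>x. x \<in> cball x0 r \<Longrightarrow> norm (\<psi> x) \<le> Z2"
    by (rule smooth_on_compact_bound[OF \<psi> cV V]) (rule that)
  define W where "W = Z1 + Z2"
  have W\<phi>: "\<phi> x \<in> cball 0 W" and W\<psi>: "\<psi> x \<in> cball 0 W" if "x \<in> cball x0 r" for x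
    using Z1(1) Z2(1) Z1(2)[OF that] Z2(2)[OF that] by (simp_all add: W_def)
  have "\<exists>L. L-lipschitz_on (cball x0 r \<times> cball 0 P) (\<lambda>(x, p). a i j x p)" for i j
  proof -
    have "compact (cball x0 r \<times> cball (0 :: real^'n) P)" by (simp add: compact_Times)
    moreover have "convex (cball x0 r \<times> cball (0 :: real^'n) P)" by (simp add: convex_Times)
    moreover have "cball x0 r \<times> cball (0 :: real^'n) P \<subseteq> \<Omega> \<times> UNIV" using V by auto
    ultimately show ?thesis by (rule smooth_on_lipschitz[OF a_smooth[of i j]]) blast
  qed
  then obtain L where L: "\<And>i j. (L i j)-lipschitz_on (cball x0 r \<times> cball 0 P) (\<lambda>(x, p). a i j x p)"
    by metis
  have "\<exists>L. L-lipschitz_on (cball x0 r \<times> cball 0 W \<times> cball 0 P) (\<lambda>(x, z, p). b x z p)"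
  proof -
    have "compact (cball x0 r \<times> cball (0 :: real) W \<times> cball (0 :: real^'n) P)"
      by (simp add: compact_Times)
    moreover have "convex (cball x0 r \<times> cball (0 :: real) W \<times> cball (0 :: real^'n) P)"
      by (simp add: convex_Times)
    moreover have "cball x0 r \<times> cball (0 :: real) W \<times> cball (0 :: real^'n) P \<subseteq> \<Omega> \<times> UNIV \<times> UNIV"
      using V by auto
    ultimately show ?thesis by (rule smooth_on_lipschitz[OF b_smooth]) blast
  qed
  then obtain Lb where Lb: "Lb-lipschitz_on (cball x0 r \<times> cball 0 W \<times> cball 0 P) (\<lambda>(x, z, p). b x z p)"
    by metis
  have L0: "L i j \<ge> 0" for i j using L by (rule lipschitz_on_nonneg)
  have Lb0: "Lb \<ge> 0" using Lb by (rule lipschitz_on_nonneg)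
  have "\<exists>B\<ge>0. \<forall>x\<in>cball x0 r. norm (vf_apply (e i) (vf_apply (e j) \<psi>) x) \<le> B" for i j
    by (rule smooth_on_compact_bound[OF smooth_on_vf_apply[OF \<open>open \<Omega>\<close> e_smooth
          smooth_on_vf_apply[OF \<open>open \<Omega>\<close> e_smooth \<psi>]] cV V]) blast
  then obtain H where H: "\<And>i j. H i j \<ge> 0"
    "\<And>i j x. x \<in> cball x0 r \<Longrightarrow> norm (vf_apply (e i) (vf_apply (e j) \<psi>) x) \<le> H i j" by metis
  have "\<exists>B\<ge>0. \<forall>x\<in>cball x0 r. norm (e i x) \<le> B" for i
    by (rule smooth_on_compact_bound[OF e_smooth cV V]) blast
  then obtain Ne where Ne: "\<And>i. Ne i \<ge> 0" "\<And>i x. x \<in> cball x0 r \<Longrightarrow> norm (e i x) \<le> Ne i" by metis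
  obtain NY where NY: "NY \<ge> 0" "\<And>x. x \<in> cball x0 r \<Longrightarrow> norm (Y x) \<le> NY"
    by (rule smooth_on_compact_bound[OF Y cV V]) (rule that)
  define N where "N = (\<Sum>i\<in>UNIV. Ne i)"
  have "N \<ge> 0" by (simp add: N_def Ne sum_nonneg)
  define S where "S = (\<Sum>i\<in>UNIV. \<Sum>j\<in>UNIV. L i j * H i j)"
  have "S \<ge> 0" by (simp add: S_def L0 H sum_nonneg)
  \<comment> \<open>In order: the change of \<open>a\<close>, the change of \<open>b\<close> in
    \<open>p\<close>, the change of \<open>b\<close> in \<open>z\<close> where \<open>u < 0\<close>,
    and the drift \<open>Y\<close>. \<open>N\<close> converts the operator norm of the derivative of
    \<open>u\<close> into a bound for \<open>p - q\<close>.\<close>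
  define C where "C = S * N + Lb * N + Lb + NY"
  have "C \<ge> 0" using \<open>S \<ge> 0\<close> \<open>N \<ge> 0\<close> Lb0 NY by (simp add: C_def)
  have "0 \<le> (\<Sum>k\<in>A. vf_apply (X k) (vf_apply (X k) u) x)
      + C * (onorm (frechet_derivative u (at x)) + max 0 (- u x))"
    if x: "x \<in> cball x0 r" for x
  proof -
    have x\<Omega>: "x \<in> \<Omega>" using x V by blast
    define o1 where "o1 = onorm (frechet_derivative u (at x))"
    define p q where "p = frame_gradient e \<phi> x" and "q = frame_gradient e \<psi> x"
    have bl: "bounded_linear (frechet_derivative u (at x))"
      by (rule has_derivative_bounded_linear[OF smooth_on_has_derivative[OF u x\<Omega>]])
    have "o1 \<ge> 0" unfolding o1_def by (rule onorm_pos_le[OF bl])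
    have du: "\<bar>vf_apply F u x\<bar> \<le> o1 * B" if "norm (F x) \<le> B" for F B
      using onorm[OF bl, of "F x"] mult_left_mono[OF that \<open>o1 \<ge> 0\<close>]
      by (simp add: vf_apply_def o1_def)
    have vf_u: "vf_apply F u x = vf_apply F \<phi> x - vf_apply F \<psi> x" if "x \<in> \<Omega>" for F x
      unfolding u_def by (rule vf_apply_diff[OF \<phi> \<psi> that])
    have pq: "norm (p - q) \<le> o1 * N"
    proof -
      have "norm (p - q) \<le> (\<Sum>i\<in>UNIV. \<bar>(p - q) $ i\<bar>)" by (rule norm_le_l1_cart)
      also have "\<dots> = (\<Sum>i\<in>UNIV. \<bar>vf_apply (e i) u x\<bar>)"
        by (simp add: p_def q_def frame_gradient_def vf_u[OF x\<Omega>])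
      also have "\<dots> \<le> (\<Sum>i\<in>UNIV. o1 * Ne i)" by (intro sum_mono du Ne x)
      finally show ?thesis by (simp add: N_def sum_distrib_left)
    qed
    have eeu: "vf_apply (e i) (vf_apply (e j) u) x
        = vf_apply (e i) (vf_apply (e j) \<phi>) x - vf_apply (e i) (vf_apply (e j) \<psi>) x" for i j
    proof -
      have s: "smooth_on \<Omega> (vf_apply (e j) \<phi>)" "smooth_on \<Omega> (vf_apply (e j) \<psi>)"
        by (intro smooth_on_vf_apply \<open>open \<Omega>\<close> e_smooth \<phi> \<psi>)+
      have "vf_apply (e i) (vf_apply (e j) u) x
          = vf_apply (e i) (\<lambda>y. vf_apply (e j) \<phi> y - vf_apply (e j) \<psi> y) x"
        by (rule vf_apply_cong[OF \<open>open \<Omega>\<close> smooth_on_diff[OF \<open>open \<Omega>\<close> s] x\<Omega> vf_u])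
      then show ?thesis by (simp add: vf_apply_diff[OF s x\<Omega>])
    qed
    have "(\<Sum>i\<in>UNIV. \<Sum>j\<in>UNIV. a i j x p * vf_apply (e i) (vf_apply (e j) u) x)
        = (\<Sum>k\<in>A. vf_apply (X k) (vf_apply (X k) u) x) + vf_apply Y u x"
      unfolding p_def by (rule sum_of_squares[OF u x\<Omega>])
    moreover have "0 \<le> (\<Sum>i\<in>UNIV. \<Sum>j\<in>UNIV. a i j x p * vf_apply (e i) (vf_apply (e j) u) x)
        + (\<Sum>i\<in>UNIV. \<Sum>j\<in>UNIV. (a i j x p - a i j x q) * vf_apply (e i) (vf_apply (e j) \<psi>) x)
        + (b x (\<phi> x) p - b x (\<psi> x) q)"
      using Q_ge[OF x\<Omega>]
      by (simp add: quasilinear_op_def p_def[symmetric] q_def[symmetric] eeu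
          algebra_simps sum.distrib sum_subtractf)
    moreover have "(\<Sum>i\<in>UNIV. \<Sum>j\<in>UNIV. (a i j x p - a i j x q) * vf_apply (e i) (vf_apply (e j) \<psi>) x)
        \<le> S * (o1 * N)"
    proof -
      have "(a i j x p - a i j x q) * vf_apply (e i) (vf_apply (e j) \<psi>) x \<le> L i j * H i j * (o1 * N)"
        for i j
      proof -
        have "\<bar>a i j x p - a i j x q\<bar> \<le> L i j * norm (p - q)"
          using lipschitz_onD[OF L[of i j], of "(x, p)" "(x, q)"] x P\<phi>[OF x] P\<psi>[OF x]
          by (simp add: p_def q_def dist_Pair_Pair dist_real_def dist_norm)
        also have "\<dots> \<le> L i j * (o1 * N)" by (rule mult_left_mono[OF pq L0])
        finally have "\<bar>a i j x p - a i j x q\<bar> * \<bar>vf_apply (e i) (vf_apply (e j) \<psi>) x\<bar>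
            \<le> L i j * (o1 * N) * H i j"
          using H(2)[OF x, of i j] by (intro mult_mono) (use L0 \<open>o1 \<ge> 0\<close> \<open>N \<ge> 0\<close> in auto)
        then show ?thesis using abs_ge_self[of "(a i j x p - a i j x q) * vf_apply (e i) (vf_apply (e j) \<psi>) x"]
          by (simp add: abs_mult mult_ac)
      qed
      then show ?thesis unfolding S_def sum_distrib_right by (intro sum_mono)
    qed
    moreover have "b x (\<phi> x) p - b x (\<phi> x) q \<le> Lb * (o1 * N)"
    proof -
      have "\<bar>b x (\<phi> x) p - b x (\<phi> x) q\<bar> \<le> Lb * norm (p - q)"
        using lipschitz_onD[OF Lb, of "(x, \<phi> x, p)" "(x, \<phi> x, q)"] x P\<phi>[OF x] P\<psi>[OF x] W\<phi>[OF x]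
        by (simp add: p_def q_def dist_Pair_Pair dist_real_def dist_norm)
      also have "\<dots> \<le> Lb * (o1 * N)" by (rule mult_left_mono[OF pq Lb0])
      finally show ?thesis by simp
    qed
    \<comment> \<open>Where \<open>u \<ge> 0\<close> monotonicity in \<open>z\<close> gives the
      sign. Where \<open>u < 0\<close> it has the wrong direction, and the Lipschitz bound leaves
      the term in \<open>u\<^sup>-\<close>.\<close>
    moreover have "b x (\<phi> x) q - b x (\<psi> x) q \<le> Lb * max 0 (- u x)"
    proof (cases "u x \<ge> 0")
      case True
      have "(\<lambda>s. b x s q) differentiable at s" for s
      proof -
        have "(\<lambda>(x, z, p). b x z p) differentiable at (x, s, q)"
          by (rule smooth_on_imp_differentiable[OF b_smooth]) (simp add: x\<Omega>)
        moreover have "(\<lambda>s. (x, s, q)) differentiable at s"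
          by (auto intro!: differentiableI derivative_eq_intros)
        ultimately show ?thesis
          using differentiable_chain_at[of "\<lambda>s. (x, s, q)" s "\<lambda>(x, z, p). b x z p"] by (simp add: o_def)
      qed
      then have "((\<lambda>s. b x s q) has_real_derivative deriv (\<lambda>s. b x s q) s) (at s)" for s
        by (simp add: DERIV_deriv_iff_real_differentiable)
      moreover have "\<psi> x \<le> \<phi> x" using True by (simp add: u_def)
      ultimately have "b x (\<phi> x) q \<le> b x (\<psi> x) q"
        using b_decreasing[OF x\<Omega>] by (intro DERIV_nonpos_imp_nonincreasing[of "\<psi> x" "\<phi> x"]) blast+
      then show ?thesis using True by simp
    next
      case False
      have "\<bar>b x (\<phi> x) q - b x (\<psi> x) q\<bar> \<le> Lb * \<bar>u x\<bar>"
        using lipschitz_onD[OF Lb, of "(x, \<phi> x, q)" "(x, \<psi> x, q)"] x P\<psi>[OF x] W\<phi>[OF x] W\<psi>[OF x]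
        by (simp add: q_def u_def dist_Pair_Pair dist_real_def)
      then show ?thesis using False by (simp add: max_def)
    qed
    moreover have "vf_apply Y u x \<le> NY * o1"
      using du[where F = Y, OF NY(2)[OF x]] by (simp add: mult.commute)
    moreover have "S * (o1 * N) + Lb * (o1 * N) + Lb * max 0 (- u x) + NY * o1
        \<le> C * (o1 + max 0 (- u x))"
    proof -
      have "0 \<le> Lb * o1 + (S * N + Lb * N + NY) * max 0 (- u x)"
        using Lb0 \<open>o1 \<ge> 0\<close> \<open>S \<ge> 0\<close> \<open>N \<ge> 0\<close> NY(1) by simp
      then show ?thesis unfolding C_def by (simp add: algebra_simps)
    qed
    ultimately show ?thesis unfolding o1_def by linarith
  qed
  then show ?thesis using \<open>C \<ge> 0\<close> unfolding u_def by blast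
qed

theorem theoremA:
  fixes m r :: nat
    and \<Omega> :: "(real^'n::finite) set"
    and e :: "'n \<Rightarrow> real^'n \<Rightarrow> real^'n"
    and a :: "'n \<Rightarrow> 'n \<Rightarrow> real^'n \<Rightarrow> real^'n \<Rightarrow> real"
    and b :: "real^'n \<Rightarrow> real \<Rightarrow> real^'n \<Rightarrow> real"
    and \<phi> \<psi> :: "real^'n \<Rightarrow> real"
    and X :: "nat \<Rightarrow> real^'n \<Rightarrow> real^'n"
    and Y Z :: "real^'n \<Rightarrow> real^'n"
    and I :: "real set"
    and \<gamma> :: "real \<Rightarrow> real^'n"
  assumes "m \<ge> 1" and "CARD('n) = m + 1"
    and "open \<Omega>" and "connected \<Omega>"
    and e_smooth: "\<And>i. smooth_on \<Omega> (e i)"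
    and e_indep: "\<And>x. x \<in> \<Omega> \<Longrightarrow> inj (\<lambda>i. e i x) \<and> independent (range (\<lambda>i. e i x))"
    and a_smooth: "\<And>i j. smooth_on (\<Omega> \<times> UNIV) (\<lambda>(x, p). a i j x p)"
    and b_smooth: "smooth_on (\<Omega> \<times> UNIV \<times> UNIV) (\<lambda>(x, z, p). b x z p)"
    and "smooth_on \<Omega> \<phi>" and "smooth_on \<Omega> \<psi>"
    and Q_ge: "\<And>x. x \<in> \<Omega> \<Longrightarrow> quasilinear_op e a b \<phi> x \<ge> quasilinear_op e a b \<psi> x"
    and a_nonneg: "\<And>x p (\<xi> :: real^'n). x \<in> \<Omega> \<Longrightarrow>
          (\<Sum>i\<in>UNIV. \<Sum>j\<in>UNIV. a i j x p * \<xi> $ i * \<xi> $ j) \<ge> 0"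
    and a_sym: "\<And>x p i j. x \<in> \<Omega> \<Longrightarrow> a i j x p = a j i x p"
    and b_decreasing: "\<And>x z p. x \<in> \<Omega> \<Longrightarrow> deriv (\<lambda>s. b x s p) z \<le> 0"
    and X_smooth: "\<And>k. k \<in> {1..r} \<Longrightarrow> smooth_on \<Omega> (X k)"
    and Y_smooth: "smooth_on \<Omega> Y"
    and sum_of_squares: "\<And>u x. smooth_on \<Omega> u \<Longrightarrow> x \<in> \<Omega> \<Longrightarrow>
          (\<Sum>i\<in>UNIV. \<Sum>j\<in>UNIV.
             a i j x (frame_gradient e \<phi> x) * vf_apply (e i) (vf_apply (e j) u) x)
          = (\<Sum>k=1..r. vf_apply (X k) (vf_apply (X k) u) x) + vf_apply Y u x"
    and Z_in: "Z \<in> lie_module \<Omega> (X ` {1..r})"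
    and curve: "integral_curve \<Omega> Z I \<gamma>"
    and max_on_curve: "\<exists>x\<^sub>0\<in>\<gamma> ` I. \<phi> x\<^sub>0 - \<psi> x\<^sub>0 \<ge> 0 \<and> (\<forall>x\<in>\<Omega>. \<phi> x - \<psi> x \<le> \<phi> x\<^sub>0 - \<psi> x\<^sub>0)"
  shows "\<forall>y\<in>\<gamma> ` I. \<forall>x\<in>\<Omega>. \<phi> x - \<psi> x \<le> \<phi> y - \<psi> y"
proof -
  define u where "u = (\<lambda>x. \<phi> x - \<psi> x)"
  have u: "smooth_on \<Omega> u"
    unfolding u_def by (rule smooth_on_diff[OF \<open>open \<Omega>\<close> \<open>smooth_on \<Omega> \<phi>\<close> \<open>smooth_on \<Omega> \<psi>\<close>])
  obtain t0 where t0: "t0 \<in> I" "u (\<gamma> t0) \<ge> 0" "\<And>x. x \<in> \<Omega> \<Longrightarrow> u x \<le> u (\<gamma> t0)"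
    using max_on_curve unfolding u_def by blast
  \<comment> \<open>The level is the maximum of \<open>u\<close> on \<open>\<Omega>\<close>,
    nonnegative by the choice of \<open>t0\<close>; this is the \<open>M \<ge> 0\<close> that the
    barrier argument needs.\<close>
  define F where "F = {x \<in> \<Omega>. u x = u (\<gamma> t0)}"
  have F: "closedin (top_of_set \<Omega>) F"
    unfolding F_def by (rule continuous_closedin_preimage_constant[OF smooth_on_imp_continuous_on[OF u]])
  have "\<exists>C\<ge>0. \<forall>x\<in>cball x0 \<rho>. 0 \<le> (\<Sum>k=1..r. vf_apply (X k) (vf_apply (X k) u) x)
      + C * (onorm (frechet_derivative u (at x)) + max 0 (- u x))"
    if "cball x0 \<rho> \<subseteq> \<Omega>" for x0 \<rho>
    unfolding u_def
    by (rule quasilinear_difference_inequality[OF \<open>open \<Omega>\<close> e_smooth a_smooth b_smooth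
          \<open>smooth_on \<Omega> \<phi>\<close> \<open>smooth_on \<Omega> \<psi>\<close> Q_ge b_decreasing Y_smooth sum_of_squares that])
  then have "tangent_to F (X k)" if "k \<in> {1..r}" for k
    unfolding F_def using that
    by (intro Hopf_tangent[OF \<open>open \<Omega>\<close> finite_atLeastAtMost u X_smooth t0(2,3)])
  then have "tangent_to F Z"
    using X_smooth by (intro tangent_to_lie_module[OF \<open>open \<Omega>\<close> F _ _ Z_in]) auto
  moreover have "smooth_on \<Omega> Z"
    using X_smooth by (intro smooth_on_lie_module[OF \<open>open \<Omega>\<close> _ Z_in]) auto
  moreover have "\<gamma> t0 \<in> F"
    using curve t0(1) by (auto simp: F_def integral_curve_def)
  ultimately have "\<gamma> ` I \<subseteq> F"
    using integral_curve_stays[OF \<open>open \<Omega>\<close> F] curve t0(1) by blast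
  then show ?thesis
    using t0(3) by (auto simp: F_def u_def)
qed

end
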